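(* (Discrete Korn inequality.) Let $(\mathcal M,\mathcal E)$ be a MAC grid of $\Omega$. For any $\boldsymbol u\in\mathbf H_{\mathcal E,0}$, $$\|\boldsymbol u\|_{1,\mathcal E,0}\le\sqrt2\,\|\mathbf D_{\widetilde{\mathcal E}}(\boldsymbol u)\|_{L^2(\Omega)}.$$
   Context: $d\in\{2,3\}$; $\Omega\subset\mathbb R^d$ is a bounded connected open set that is a finite union of rectangles ($d=2$) or rectangular parallelepipeds ($d=3$) with faces orthogonal to the canonical basis vectors $e_1,\dots,e_d$. **MAC grid** $(\mathcal M,\mathcal E)$. $\mathcal M$ is a conforming structured (possibly non-uniform) partition of $\Omega$ into axis-parallel rectangles/parallelepipeds $K$. $\mathcal E$ is the set of faces (edges if $d=2$) $\sigma$ of the cells, with centre $x_\sigma$; $\mathcal E_{\rm int},\mathcal E_{\rm ext}$: faces in the interior / on the boundary of $\Omega$; $\mathcal E^{(i)}$: faces orthogonal to $e_i$; $\mathcal E^{(i)}_{\rm ext}=\mathcal E^{(i)}\cap\mathcal E_{\rm ext}$. $\sigma=K|L$: interior face common to $K$ and $L$. $D_{K,\sigma}$: half of $K$ adjacent to its face $\sigma$; $D_\sigma=D_{K,\sigma}\cup D_{L,\sigma}$ if $\sigma=K|L$, $D_\sigma=D_{K,\sigma}$ if $\sigma$ is an exterior face of $K$. **Dual faces.** $\widetilde{\mathcal E}^{(i)}$: all faces $\epsilon$ of the cells $D_\sigma$, $\sigma\in\mathcal E^{(i)}$; $\widetilde{\mathcal E}^{(i,j)}$: those orthogonal to $e_j$;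 $\epsilon=\sigma|\sigma'$: common face of $D_\sigma$ and $D_{\sigma'}$; $n_{\sigma,\epsilon}$: unit normal to $\epsilon$ outward $D_\sigma$. For $\epsilon\in\widetilde{\mathcal E}^{(i,j)}$: $D_\epsilon=\epsilon\times[x_\sigma,x_{\sigma'}]$, $d_\epsilon=|x_\sigma-x_{\sigma'}|$ if $\epsilon=\sigma|\sigma'$; $D_\epsilon=\epsilon\times[x_\sigma,x_{\sigma,\epsilon}]$, $d_\epsilon=|x_\sigma-x_{\sigma,\epsilon}|$ if $\epsilon\subset\partial\Omega$ is a face of $D_\sigma$, with $x_{\sigma,\epsilon}$ the orthogonal projection of $x_\sigma$ on $\epsilon$ (degenerate ones with $d_\epsilon=0$ are discarded). For each $(i,j)$ the $D_\epsilon$ partition $\Omega$; for $i=j$ they are the primal cells; the $(i,j)$- and $(j,i)$-partitions are taken to coincide. **Space and operators.** $\mathbf H_{\mathcal E,0}=\prod_{i=1}^dH_{\mathcal E^{(i)},0}$, where $H_{\mathcal E^{(i)},0}$ is the set of functions $\sum_{\sigma\in\mathcal E^{(i)}}v_\sigma\mathbf 1_{D_\sigma}$ with $v_\sigma=0$ for $\sigma\in\mathcal E^{(i)}_{\rm ext}$. For $\boldsymbol u=(u_1,\dots,u_d)\in\mathbf H_{\mathcal E,0}$, $\eth_ju_i=\sum_{\epsilon\in\widetilde{\mathcal E}^{(i,j)}}(\eth_ju_i)_{D_\epsilon}\mathbf 1_{D_\epsilon}$ with $(\eth_ju_i)_{D_\epsilon}=\frac{u_{\sigma'}-u_\sigma}{d_\epsilon}\,n_{\sigma,\epsilon}\cdot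 e_j$ if $\epsilon=\sigma|\sigma'$ and $(\eth_ju_i)_{D_\epsilon}=\frac{-u_\sigma}{d_\epsilon}\,n_{\sigma,\epsilon}\cdot e_j$ if $\epsilon\subset\partial\Omega$ is a face of $D_\sigma$. Norm: $\|\boldsymbol u\|^2_{1,\mathcal E,0}=\sum_{i,j=1}^d\|\eth_ju_i\|^2_{L^2(\Omega)}$ (equivalently $\sum_i\big(\sum_{\epsilon=\sigma|\sigma'\in\widetilde{\mathcal E}^{(i)}}\frac{|\epsilon|}{d_\epsilon}(u_\sigma-u_{\sigma'})^2+\sum_{\epsilon\subset\partial\Omega\cap\partial D_\sigma}\frac{|\epsilon|}{d_\epsilon}u_\sigma^2\big)$). Discrete strain: $\mathbf D_{\widetilde{\mathcal E}}(\boldsymbol u)=\big(\frac12(\eth_ju_i+\eth_iu_j)\big)_{i,j}$, with $\|\mathbf D_{\widetilde{\mathcal E}}(\boldsymbol u)\|^2_{L^2(\Omega)}=\sum_{i,j}\|\frac12(\eth_ju_i+\eth_iu_j)\|^2_{L^2(\Omega)}$. *)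

theory Defs
  imports "HOL-Analysis.Analysis"
begin

text \<open>
  The space is \<open>real ^ 'n\<close> with \<open>CARD('n) = d\<close>; the index \<open>i :: 'n\<close> stands for the direction
  \<open>e\<^sub>i = axis i 1\<close>. Cells, faces, dual cells and dual faces are closed sets of points. A face is
  a box degenerate in exactly one direction. Partitions are understood up to null sets.
\<close>

definition centre :: "(real ^ 'n) set \<Rightarrow> real ^ 'n" where
  "centre S = midpoint (interval_lowerbound S) (interval_upperbound S)"

definition box_faces :: "'n \<Rightarrow> (real ^ 'n) set \<Rightarrow> (real ^ 'n) set set" where
  "box_faces i K =
     {K \<inter> {x. x $ i = interval_lowerbound K $ i}, K \<inter> {x. x $ i = interval_upperbound K $ i}}"

definition is_facet :: "'n \<Rightarrow> (real ^ 'n) set \<Rightarrow> bool" where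
  "is_facet j S \<longleftrightarrow> (\<exists>a b. S = cbox a b \<and> a $ j = b $ j \<and> (\<forall>k. k \<noteq> j \<longrightarrow> a $ k < b $ k))"


section \<open>Domain and primal mesh\<close>

text \<open>
  An open set is a union of closed boxes only up to its boundary, hence the interior; taking the
  interior also rules out slits, so that an exterior face belongs to exactly one cell.
\<close>

definition mac_domain :: "(real ^ 'n) set \<Rightarrow> bool" where
  "mac_domain \<Omega> \<longleftrightarrow>
     open \<Omega> \<and> bounded \<Omega> \<and> connected \<Omega> \<and>
     (\<exists>R. finite R \<and> (\<forall>B\<in>R. \<exists>a b. (\<forall>k. a $ k < b $ k) \<and> B = cbox a b) \<and> \<Omega> = interior (\<Union>R))"

text \<open>
  Structured and conforming: every cell is a product of intervals between consecutive grid
  coordinates, \<open>G k\<close> being the (possibly non-uniform) grid coordinates in direction \<open>k\<close>.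
\<close>

definition mac_mesh :: "(real ^ 'n) set \<Rightarrow> (real ^ 'n) set set \<Rightarrow> bool" where
  "mac_mesh \<Omega> M \<longleftrightarrow>
     \<Union>M = closure \<Omega> \<and>
     (\<exists>G :: 'n \<Rightarrow> real set. (\<forall>k. finite (G k)) \<and>
        (\<forall>K\<in>M. \<exists>a b. K = cbox a b \<and>
           (\<forall>k. a $ k < b $ k \<and> {a $ k..b $ k} \<inter> G k = {a $ k, b $ k})))"

definition mac_faces :: "(real ^ 'n) set set \<Rightarrow> 'n \<Rightarrow> (real ^ 'n) set set" where
  "mac_faces M i = (\<Union>K\<in>M. box_faces i K)"

definition ext_faces :: "(real ^ 'n) set \<Rightarrow> (real ^ 'n) set set \<Rightarrow> 'n \<Rightarrow> (real ^ 'n) set set" where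
  "ext_faces \<Omega> M i = {\<sigma> \<in> mac_faces M i. \<sigma> \<subseteq> frontier \<Omega>}"

definition half_cell :: "'n \<Rightarrow> (real ^ 'n) set \<Rightarrow> (real ^ 'n) set \<Rightarrow> (real ^ 'n) set" where
  "half_cell i K \<sigma> = {x \<in> K. x $ i \<in> closed_segment (centre \<sigma> $ i) (centre K $ i)}"

definition dual_cell :: "(real ^ 'n) set set \<Rightarrow> 'n \<Rightarrow> (real ^ 'n) set \<Rightarrow> (real ^ 'n) set" where
  "dual_cell M i \<sigma> = \<Union>{half_cell i K \<sigma> |K. K \<in> M \<and> \<sigma> \<in> box_faces i K}"


section \<open>Dual faces\<close>

text \<open>
  \<open>dual_face \<Omega> M i j \<epsilon> \<sigma> N\<close>: \<open>\<epsilon>\<close> is a face, orthogonal to \<open>e\<^sub>j\<close>, of the dual cell of \<open>\<sigma>\<close>, which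
  it separates from the dual cell of \<open>\<sigma>'\<close> if \<open>N = Some \<sigma>'\<close> (that is, \<open>\<epsilon> = \<sigma>|\<sigma>'\<close>) and from the
  exterior of \<open>\<Omega>\<close> if \<open>N = None\<close>. Faces are taken in the sense of meshes: at a reentrant corner a
  side of the dual cell of \<open>\<sigma>\<close> may meet another dual cell along one half only and \<open>\<partial>\<Omega>\<close> along the
  other half; these halves are then two dual faces. The closure of the relative interior
  merely discards lower-dimensional parts of the intersection with the boundary.
\<close>

definition common_face ::
  "(real ^ 'n) set set \<Rightarrow> 'n \<Rightarrow> 'n \<Rightarrow> (real ^ 'n) set \<Rightarrow> (real ^ 'n) set \<Rightarrow> (real ^ 'n) set \<Rightarrow> bool" where
  "common_face M i j \<epsilon> \<sigma> \<sigma>' \<longleftrightarrow>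
     \<sigma> \<in> mac_faces M i \<and> \<sigma>' \<in> mac_faces M i \<and> \<sigma> \<noteq> \<sigma>' \<and>
     \<epsilon> = dual_cell M i \<sigma> \<inter> dual_cell M i \<sigma>' \<and> is_facet j \<epsilon>"

definition boundary_face ::
  "(real ^ 'n) set \<Rightarrow> (real ^ 'n) set set \<Rightarrow> 'n \<Rightarrow> 'n \<Rightarrow> (real ^ 'n) set \<Rightarrow> (real ^ 'n) set \<Rightarrow> bool" where
  "boundary_face \<Omega> M i j \<epsilon> \<sigma> \<longleftrightarrow>
     \<sigma> \<in> mac_faces M i \<and> \<epsilon> \<noteq> {} \<and>
     (\<exists>F \<in> box_faces j (dual_cell M i \<sigma>). \<epsilon> = closure (rel_interior F \<inter> frontier \<Omega>))"

definition far_point ::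
  "(real ^ 'n) set \<Rightarrow> (real ^ 'n) set \<Rightarrow> (real ^ 'n) set option \<Rightarrow> real ^ 'n" where
  "far_point \<epsilon> \<sigma> N = (case N of Some \<sigma>' \<Rightarrow> centre \<sigma>' | None \<Rightarrow> closest_point \<epsilon> (centre \<sigma>))"

definition dual_face ::
  "(real ^ 'n) set \<Rightarrow> (real ^ 'n) set set \<Rightarrow> 'n \<Rightarrow> 'n \<Rightarrow>
   (real ^ 'n) set \<Rightarrow> (real ^ 'n) set \<Rightarrow> (real ^ 'n) set option \<Rightarrow> bool" where
  "dual_face \<Omega> M i j \<epsilon> \<sigma> N \<longleftrightarrow>
     (case N of Some \<sigma>' \<Rightarrow> common_face M i j \<epsilon> \<sigma> \<sigma>' | None \<Rightarrow> boundary_face \<Omega> M i j \<epsilon> \<sigma>) \<and>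
     dist (centre \<sigma>) (far_point \<epsilon> \<sigma> N) > 0"

definition dual_faces ::
  "(real ^ 'n) set \<Rightarrow> (real ^ 'n) set set \<Rightarrow> 'n \<Rightarrow> 'n \<Rightarrow> (real ^ 'n) set set" where
  "dual_faces \<Omega> M i j = {\<epsilon>. \<exists>\<sigma> N. dual_face \<Omega> M i j \<epsilon> \<sigma> N}"

text \<open>
  The two sides of a dual face. For \<open>\<epsilon> = \<sigma>|\<sigma>'\<close> the choice between \<open>(\<sigma>, Some \<sigma>')\<close> and
  \<open>(\<sigma>', Some \<sigma>)\<close> is immaterial: everything below is symmetric in \<open>\<sigma>\<close> and \<open>\<sigma>'\<close>.
\<close>

definition sides ::
  "(real ^ 'n) set \<Rightarrow> (real ^ 'n) set set \<Rightarrow> 'n \<Rightarrow> 'n \<Rightarrow> (real ^ 'n) set \<Rightarrow>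
   (real ^ 'n) set \<times> (real ^ 'n) set option" where
  "sides \<Omega> M i j \<epsilon> = (SOME (\<sigma>, N). dual_face \<Omega> M i j \<epsilon> \<sigma> N)"

definition d_face ::
  "(real ^ 'n) set \<Rightarrow> (real ^ 'n) set set \<Rightarrow> 'n \<Rightarrow> 'n \<Rightarrow> (real ^ 'n) set \<Rightarrow> real" where
  "d_face \<Omega> M i j \<epsilon> = (case sides \<Omega> M i j \<epsilon> of (\<sigma>, N) \<Rightarrow> dist (centre \<sigma>) (far_point \<epsilon> \<sigma> N))"

text \<open>\<open>D\<^sub>\<epsilon> = \<epsilon> \<times> [x\<^sub>\<sigma>, y]\<close>, where the segment is parallel to \<open>e\<^sub>j\<close>.\<close>

definition face_cell ::
  "(real ^ 'n) set \<Rightarrow> (real ^ 'n) set set \<Rightarrow> 'n \<Rightarrow> 'n \<Rightarrow> (real ^ 'n) set \<Rightarrow> (real ^ 'n) set" where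
  "face_cell \<Omega> M i j \<epsilon> = (case sides \<Omega> M i j \<epsilon> of (\<sigma>, N) \<Rightarrow>
     {x. \<exists>y\<in>\<epsilon>. (\<forall>k. k \<noteq> j \<longrightarrow> x $ k = y $ k) \<and>
               x $ j \<in> closed_segment (centre \<sigma> $ j) (far_point \<epsilon> \<sigma> N $ j)})"

text \<open>
  The standing convention that the \<open>(i,j)\<close>- and \<open>(j,i)\<close>-partitions coincide. It is a genuine
  condition: it fails where the mesh has a reentrant corner (or edge), the two partitions then
  splitting the neighbourhood of the corner in two different ways.
\<close>

definition dual_partitions_coincide :: "(real ^ 'n) set \<Rightarrow> (real ^ 'n) set set \<Rightarrow> bool" where
  "dual_partitions_coincide \<Omega> M \<longleftrightarrow>
     (\<forall>i j. face_cell \<Omega> M i j ` dual_faces \<Omega> M i j = face_cell \<Omega> M j i ` dual_faces \<Omega> M j i)"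

definition outer_normal :: "'n \<Rightarrow> (real ^ 'n) set \<Rightarrow> (real ^ 'n) set \<Rightarrow> real ^ 'n" where
  "outer_normal j S \<epsilon> =
     (if \<epsilon> \<subseteq> {x. x $ j = interval_upperbound S $ j} then axis j 1 else - axis j 1)"


section \<open>Discrete velocities, derivatives and norms\<close>

text \<open>Piecewise constant functions use interiors of cells, so that cells do not overlap.\<close>

definition mac_component_space ::
  "(real ^ 'n) set \<Rightarrow> (real ^ 'n) set set \<Rightarrow> 'n \<Rightarrow> (real ^ 'n \<Rightarrow> real) set" where
  "mac_component_space \<Omega> M i =
     {f. \<exists>v :: (real ^ 'n) set \<Rightarrow> real. (\<forall>\<sigma> \<in> ext_faces \<Omega> M i. v \<sigma> = 0) \<and>
         f = (\<lambda>x. \<Sum>\<sigma> \<in> mac_faces M i. v \<sigma> * indicator (interior (dual_cell M i \<sigma>)) x)}"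

definition mac_space ::
  "(real ^ 'n) set \<Rightarrow> (real ^ 'n) set set \<Rightarrow> (real ^ 'n \<Rightarrow> real ^ 'n) set" where
  "mac_space \<Omega> M = {u. \<forall>i. (\<lambda>x. u x $ i) \<in> mac_component_space \<Omega> M i}"

text \<open>
  The coefficient \<open>u\<^sub>\<sigma>\<close>: the value of \<open>u\<^sub>i\<close> in the dual cell of \<open>\<sigma>\<close>, read off at the centre of
  that cell (the centre of \<open>\<sigma>\<close> itself need not be an interior point).
\<close>

definition coef :: "(real ^ 'n) set set \<Rightarrow> (real ^ 'n \<Rightarrow> real ^ 'n) \<Rightarrow> 'n \<Rightarrow> (real ^ 'n) set \<Rightarrow> real" where
  "coef M u i \<sigma> = u (centre (dual_cell M i \<sigma>)) $ i"

definition deriv_coef ::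
  "(real ^ 'n) set \<Rightarrow> (real ^ 'n) set set \<Rightarrow> 'n \<Rightarrow> 'n \<Rightarrow>
   (real ^ 'n \<Rightarrow> real ^ 'n) \<Rightarrow> (real ^ 'n) set \<Rightarrow> real" where
  "deriv_coef \<Omega> M i j u \<epsilon> = (case sides \<Omega> M i j \<epsilon> of (\<sigma>, N) \<Rightarrow>
     ((case N of Some \<sigma>' \<Rightarrow> coef M u i \<sigma>' | None \<Rightarrow> 0) - coef M u i \<sigma>) / d_face \<Omega> M i j \<epsilon>
       * (outer_normal j (dual_cell M i \<sigma>) \<epsilon> \<bullet> axis j 1))"

text \<open>\<open>discrete_deriv \<Omega> M i j u\<close> is the discrete derivative of \<open>u\<^sub>i\<close> in the direction \<open>e\<^sub>j\<close>.\<close>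

definition discrete_deriv ::
  "(real ^ 'n) set \<Rightarrow> (real ^ 'n) set set \<Rightarrow> 'n \<Rightarrow> 'n \<Rightarrow>
   (real ^ 'n \<Rightarrow> real ^ 'n) \<Rightarrow> real ^ 'n \<Rightarrow> real" where
  "discrete_deriv \<Omega> M i j u x =
     (\<Sum>\<epsilon> \<in> dual_faces \<Omega> M i j. deriv_coef \<Omega> M i j u \<epsilon> * indicator (interior (face_cell \<Omega> M i j \<epsilon>)) x)"

definition L2_norm_on :: "(real ^ 'n) set \<Rightarrow> (real ^ 'n \<Rightarrow> real) \<Rightarrow> real" where
  "L2_norm_on \<Omega> f = sqrt (LINT x:\<Omega>|lebesgue. (f x)\<^sup>2)"

definition norm_1E0 ::
  "(real ^ 'n) set \<Rightarrow> (real ^ 'n) set set \<Rightarrow> (real ^ 'n \<Rightarrow> real ^ 'n) \<Rightarrow> real" where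
  "norm_1E0 \<Omega> M u =
     sqrt (\<Sum>i\<in>UNIV. \<Sum>j\<in>UNIV. (L2_norm_on \<Omega> (discrete_deriv \<Omega> M i j u))\<^sup>2)"

definition discrete_strain ::
  "(real ^ 'n) set \<Rightarrow> (real ^ 'n) set set \<Rightarrow> (real ^ 'n \<Rightarrow> real ^ 'n) \<Rightarrow> real ^ 'n \<Rightarrow> real ^ 'n ^ 'n" where
  "discrete_strain \<Omega> M u x =
     (\<chi> i j. (discrete_deriv \<Omega> M i j u x + discrete_deriv \<Omega> M j i u x) / 2)"

definition matrix_L2_norm_on :: "(real ^ 'n) set \<Rightarrow> (real ^ 'n \<Rightarrow> real ^ 'n ^ 'n) \<Rightarrow> real" where
  "matrix_L2_norm_on \<Omega> A =
     sqrt (\<Sum>i\<in>UNIV. \<Sum>j\<in>UNIV. (L2_norm_on \<Omega> (\<lambda>x. A x $ i $ j))\<^sup>2)"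

end

theory Submission
  imports Defs "HOL-Library.Groups_Big_Fun"
begin

text \<open>
  Write \<open>a\<^sub>i\<^sub>j\<close> for the discrete derivative of \<open>u\<^sub>i\<close> in the direction \<open>e\<^sub>j\<close>. Expanding the square,
  twice the squared norm of the strain is \<open>\<Sum>\<^sub>i\<^sub>j \<integral> a\<^sub>i\<^sub>j\<^sup>2 + \<Sum>\<^sub>i\<^sub>j \<integral> a\<^sub>i\<^sub>j a\<^sub>j\<^sub>i\<close>, so it suffices that the mixed term is
  nonnegative. As in the continuous case \<open>\<integral> a\<^sub>i\<^sub>j a\<^sub>j\<^sub>i = \<integral> a\<^sub>i\<^sub>i a\<^sub>j\<^sub>j\<close>, and the mixed term is the integral
  of the squared discrete divergence. For \<open>i \<noteq> j\<close> both integrals are sums over the grid, the left one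
  over vertices (edges if \<open>d = 3\<close>), the right one over cells, and they agree by summation by parts
  for the coefficients extended by zero. Writing the left integral as such a sum fails only at
  reentrant corners, where the cells \<open>D\<^sub>\<epsilon>\<close> are cut differently for \<open>(i,j)\<close> and \<open>(j,i)\<close>;
  the coincidence of the two partitions rules these corners out.
\<close>

section \<open>Indexed grids\<close>

text \<open>Near the boundary the dual cells are truncated and their sides may split, so the sets
  \<open>face_cell\<close> take many shapes. These are not classified. Space is cut instead into
  boxes \<open>vbox\<close> that ignore the domain. A dual face whose cell meets such a box involves
  no coefficients but those of the two faces that the box joins; so either enough cells surround the
  box for the derivative to be an explicit difference quotient, or the boundary condition must make
  coefficients vanish. For \<open>i \<noteq> j\<close> a nonzero product calls for two cells
  adjacent in direction \<open>i\<close> and two adjacent in direction \<open>j\<close> around one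
  vertex, hence for three of the four cells there; the coincidence of the partitions supplies the
  fourth. The side lengths of the box in directions \<open>i\<close> and \<open>j\<close> cancel the
  denominators of the quotients. What remains, \<open>weight\<close>, depends on neither
  \<open>m i\<close> nor \<open>m j\<close>, which is why summation by parts works on a non-uniform
  grid.\<close>

lemma strict_mono_gap_unique:
  fixes f :: "int \<Rightarrow> real"
  assumes "strict_mono f" "f n < x" "x < f (n + 1)" "f p \<le> x" "x \<le> f (p + 1)"
  shows "p = n"
proof -
  have "f p < f (n + 1)" "f n < f (p + 1)" using assms(2-5) by linarith+
  then have "p < n + 1" "n < p + 1" using strict_mono_less[OF assms(1)] by blast+
  then show ?thesis by linarith
qed

lemma strict_mono_gap_adjacent:
  fixes f :: "int \<Rightarrow> real"
  assumes "strict_mono f" "f p \<le> x" "x \<le> f (p + 1)" "f q \<le> x" "x \<le> f (q + 1)" "p < q"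
  shows "q = p + 1"
proof -
  have "f q \<le> f (p + 1)" using assms by linarith
  then have "q \<le> p + 1" using strict_mono_less_eq[OF assms(1)] by blast
  then show ?thesis using assms(6) by linarith
qed

lemma all_split_at: "(\<forall>k. P k) \<longleftrightarrow> P i \<and> (\<forall>k. k \<noteq> i \<longrightarrow> P k)"
  by metis

lemma centre_cbox_cart:
  fixes a b :: "real ^ 'n"
  assumes "\<And>k. a $ k \<le> b $ k"
  shows "centre (cbox a b) $ k = (a $ k + b $ k) / 2"
proof -
  have "cbox a b \<noteq> {}" using assms by (simp add: interval_ne_empty_cart)
  then show ?thesis by (simp add: centre_def interval_bounds' midpoint_def)
qed

lemma box_faces_cbox:
  fixes a b :: "real ^ 'n"
  assumes "\<And>k. a $ k \<le> b $ k"
  shows "box_faces j (cbox a b) = {cbox a b \<inter> {x. x $ j = a $ j}, cbox a b \<inter> {x. x $ j = b $ j}}"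
proof -
  have "cbox a b \<noteq> {}" using assms by (simp add: interval_ne_empty_cart)
  then show ?thesis by (simp add: box_faces_def interval_bounds')
qed

text \<open>
  Cells are indexed by \<open>m :: 'n \<Rightarrow> int\<close>, \<open>A\<close> being the indices of the cells in the mesh; the finite grid
  is extended to an infinite one in every direction, so that index shifts need no side conditions.
\<close>

locale mac_grid =
  fixes g :: "'n::finite \<Rightarrow> int \<Rightarrow> real" and A :: "('n \<Rightarrow> int) set"
  assumes grid_mono: "strict_mono (g k)"
    and grid_cover: "\<exists>n. g k n \<le> t \<and> t < g k (n + 1)"
    and finite_cells: "finite A"
begin

definition mid :: "'n \<Rightarrow> int \<Rightarrow> real" where
  "mid k n = (g k n + g k (n + 1)) / 2"

definition cell :: "('n \<Rightarrow> int) \<Rightarrow> (real ^ 'n) set" where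
  "cell m = cbox (\<chi> k. g k (m k)) (\<chi> k. g k (m k + 1))"

text \<open>A face carries the index of the cell above it: \<open>face i m\<close> lies between the
  cells \<open>m(i := m i - 1)\<close> and \<open>m\<close>. An exterior face at an upper end thus
  has an index outside \<open>A\<close>.\<close>

definition face :: "'n \<Rightarrow> ('n \<Rightarrow> int) \<Rightarrow> (real ^ 'n) set" where
  "face i m = cbox (\<chi> k. g k (m k)) (\<chi> k. g k (if k = i then m k else m k + 1))"

definition mesh :: "(real ^ 'n) set set" where
  "mesh = cell ` A"

definition dom :: "(real ^ 'n) set" where
  "dom = interior (\<Union>mesh)"

text \<open>
  \<open>tick i k\<close> and \<open>ctick i k\<close> list the ends and the centres, in the direction \<open>e\<^sub>k\<close>, of the dual cells of
  the faces orthogonal to \<open>e\<^sub>i\<close>. The ends are those of interior faces: the dual cell of an exterior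
  face stops at the face, which \<open>dlo\<close> and \<open>dhi\<close> take into account.
\<close>

definition tick :: "'n \<Rightarrow> 'n \<Rightarrow> int \<Rightarrow> real" where
  "tick i k n = (if k = i then mid k (n - 1) else g k n)"

definition ctick :: "'n \<Rightarrow> 'n \<Rightarrow> int \<Rightarrow> real" where
  "ctick i k n = (if k = i then g k n else mid k n)"

definition dlo :: "'n \<Rightarrow> ('n \<Rightarrow> int) \<Rightarrow> 'n \<Rightarrow> real" where
  "dlo i m k = (if k = i \<and> m(i := m i - 1) \<notin> A then g i (m i) else tick i k (m k))"

definition dhi :: "'n \<Rightarrow> ('n \<Rightarrow> int) \<Rightarrow> 'n \<Rightarrow> real" where
  "dhi i m k = (if k = i \<and> m \<notin> A then g i (m i) else tick i k (m k + 1))"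

definition is_face :: "'n \<Rightarrow> ('n \<Rightarrow> int) \<Rightarrow> bool" where
  "is_face i m \<longleftrightarrow> m \<in> A \<or> m(i := m i - 1) \<in> A"

section \<open>Order of the grid coordinates; cells, faces and dual cells as boxes\<close>

lemma grid_less [simp]: "g k p < g k q \<longleftrightarrow> p < q"
  using grid_mono strict_mono_less by blast

lemma grid_le [simp]: "g k p \<le> g k q \<longleftrightarrow> p \<le> q"
  using grid_mono strict_mono_less_eq by blast

lemma grid_eq [simp]: "g k p = g k q \<longleftrightarrow> p = q"
  using grid_mono strict_mono_eq by blast

lemma mid_between: "g k n < mid k n" "mid k n < g k (n + 1)"
  using grid_less[of k n "n + 1"] by (auto simp: mid_def field_simps simp del: grid_less)

lemma mid_mono: "strict_mono (mid k)"
proof (rule strict_monoI)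
  fix p q :: int assume "p < q"
  then show "mid k p < mid k q"
    unfolding mid_def by (intro divide_strict_right_mono add_strict_mono) simp_all
qed

lemma tick_mono: "strict_mono (tick i k)"
  using mid_mono[of k] grid_mono[of k] by (auto simp: tick_def strict_mono_def)

lemma ctick_mono: "strict_mono (ctick i k)"
  using mid_mono[of k] grid_mono[of k] by (auto simp: ctick_def strict_mono_def)

lemma tick_less [simp]: "tick i k p < tick i k q \<longleftrightarrow> p < q"
  using tick_mono strict_mono_less by blast

lemma tick_le [simp]: "tick i k p \<le> tick i k q \<longleftrightarrow> p \<le> q"
  using tick_mono strict_mono_less_eq by blast

lemma ctick_less [simp]: "ctick i k p < ctick i k q \<longleftrightarrow> p < q"
  using ctick_mono strict_mono_less by blast

lemma tick_ctick: "tick i k n < ctick i k n" "ctick i k n < tick i k (n + 1)"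
  using mid_between[of k n] mid_between[of k "n - 1"] by (auto simp: tick_def ctick_def)

lemma mem_cell: "x \<in> cell m \<longleftrightarrow> (\<forall>k. g k (m k) \<le> x $ k \<and> x $ k \<le> g k (m k + 1))"
  by (simp add: cell_def mem_box_cart)

lemma mem_cell_at: "x \<in> cell m \<longleftrightarrow> (g i (m i) \<le> x $ i \<and> x $ i \<le> g i (m i + 1)) \<and>
   (\<forall>k. k \<noteq> i \<longrightarrow> g k (m k) \<le> x $ k \<and> x $ k \<le> g k (m k + 1))"
  unfolding mem_cell by (rule all_split_at)

lemma mem_face: "x \<in> face i m \<longleftrightarrow>
   x $ i = g i (m i) \<and> (\<forall>k. k \<noteq> i \<longrightarrow> g k (m k) \<le> x $ k \<and> x $ k \<le> g k (m k + 1))"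
  unfolding face_def mem_box_cart by (subst all_split_at[of _ i]) auto

lemma face_inj [simp]: "face i m = face i p \<longleftrightarrow> m = p"
proof
  assume eq: "face i m = face i p"
  have "cbox (\<chi> k. g k (m k)) (\<chi> k. g k (if k = i then m k else m k + 1)) \<noteq> {}"
    by (simp add: interval_ne_empty_cart)
  then have "(\<chi> k. g k (m k)) = (\<chi> k. g k (p k))"
    using eq unfolding face_def eq_cbox by auto
  then show "m = p" by (simp add: vec_eq_iff fun_eq_iff)
qed simp

lemma box_faces_cell: "box_faces i (cell m) = {face i m, face i (m(i := m i + 1))}"
proof -
  have "cell m \<inter> {x. x $ i = g i (m i)} = face i m"
    by (auto simp: mem_cell_at[of _ _ i] mem_face)
  moreover have "cell m \<inter> {x. x $ i = g i (m i + 1)} = face i (m(i := m i + 1))"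
    by (auto simp: mem_cell_at[of _ _ i] mem_face)
  ultimately show ?thesis
    unfolding cell_def by (subst box_faces_cbox) simp_all
qed

lemma mac_faces_mesh: "mac_faces mesh i = face i ` {m. is_face i m}"
proof -
  have "m(i := m i + 1) = p \<longleftrightarrow> m = p(i := p i - 1)" for m p :: "'n \<Rightarrow> int"
    by (auto simp: fun_eq_iff)
  then show ?thesis
    unfolding mac_faces_def mesh_def
    by (auto simp: box_faces_cell is_face_def)
qed

lemma finite_faces: "finite (mac_faces mesh i)"
  using finite_cells by (auto simp: mac_faces_def mesh_def box_faces_cell)

lemma centre_face: "centre (face i m) $ k = ctick i k (m k)"
  unfolding face_def by (subst centre_cbox_cart) (auto simp: ctick_def mid_def)

lemma centre_cell: "centre (cell m) $ k = mid k (m k)"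
  unfolding cell_def by (subst centre_cbox_cart) (auto simp: mid_def)

lemma dlo_dhi:
  "tick i k (m k) \<le> dlo i m k" "dhi i m k \<le> tick i k (m k + 1)"
  "is_face i m \<Longrightarrow> dlo i m k < dhi i m k"
  using tick_ctick[of i k "m k"] by (auto simp: dlo_def dhi_def is_face_def tick_def ctick_def)

lemma half_cell_upper:
  "half_cell i (cell m) (face i m) = {x \<in> cell m. g i (m i) \<le> x $ i \<and> x $ i \<le> mid i (m i)}"
  using mid_between[of i "m i"]
  by (auto simp: half_cell_def centre_face centre_cell ctick_def closed_segment_eq_real_ivl)

lemma half_cell_lower:
  "half_cell i (cell (m(i := m i - 1))) (face i m) =
     {x \<in> cell (m(i := m i - 1)). mid i (m i - 1) \<le> x $ i \<and> x $ i \<le> g i (m i)}"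
  using mid_between[of i "m i - 1"]
  by (auto simp: half_cell_def centre_face centre_cell ctick_def closed_segment_eq_real_ivl)

lemma mem_half_cell_upper:
  "x \<in> half_cell i (cell m) (face i m) \<longleftrightarrow>
    (\<forall>k. k \<noteq> i \<longrightarrow> tick i k (m k) \<le> x $ k \<and> x $ k \<le> tick i k (m k + 1)) \<and>
    g i (m i) \<le> x $ i \<and> x $ i \<le> tick i i (m i + 1)"
  using mid_between[of i "m i"]
  by (auto simp: half_cell_upper mem_cell_at[of _ _ i] tick_def)

lemma mem_half_cell_lower:
  "x \<in> half_cell i (cell (m(i := m i - 1))) (face i m) \<longleftrightarrow>
    (\<forall>k. k \<noteq> i \<longrightarrow> tick i k (m k) \<le> x $ k \<and> x $ k \<le> tick i k (m k + 1)) \<and>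
    tick i i (m i) \<le> x $ i \<and> x $ i \<le> g i (m i)"
  using mid_between[of i "m i - 1"]
  by (auto simp: half_cell_lower mem_cell_at[of _ _ i] tick_def)

lemma dual_cell_face:
  assumes "is_face i m"
  shows "dual_cell mesh i (face i m) = cbox (\<chi> k. dlo i m k) (\<chi> k. dhi i m k)"
proof -
  let ?m' = "m(i := m i - 1)"
  have inv: "m = p(i := p i + 1) \<longleftrightarrow> p = ?m'" for p :: "'n \<Rightarrow> int"
    by (auto simp: fun_eq_iff)
  have mem: "x \<in> dual_cell mesh i (face i m) \<longleftrightarrow>
      (m \<in> A \<and> x \<in> half_cell i (cell m) (face i m)) \<or>
      (?m' \<in> A \<and> x \<in> half_cell i (cell ?m') (face i m))" for x
    unfolding dual_cell_def mesh_def
    by (auto simp: box_faces_cell inv) (auto simp: box_faces_cell intro!: exI conjI)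
  have tk: "tick i i (m i) < g i (m i)" "g i (m i) < tick i i (m i + 1)"
    using tick_ctick[of i i "m i"] by (simp_all add: ctick_def)
  show ?thesis
  proof (rule set_eqI)
    fix x
    show "x \<in> dual_cell mesh i (face i m) \<longleftrightarrow> x \<in> cbox (\<chi> k. dlo i m k) (\<chi> k. dhi i m k)"
      unfolding mem mem_half_cell_upper mem_half_cell_lower mem_box_cart
        all_split_at[of "\<lambda>k. (\<chi> k. dlo i m k) $ k \<le> x $ k \<and> x $ k \<le> (\<chi> k. dhi i m k) $ k" i]
      using assms tk by (auto simp: dlo_def dhi_def is_face_def)
  qed
qed

text \<open>Truncation only shrinks a dual cell, so these bounds hold at the boundary too. Together
  with \<open>strict_mono_gap_unique\<close> they recover the index of a face from a point of its
  dual cell.\<close>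

lemma dual_cell_tick:
  assumes "is_face i m" "x \<in> dual_cell mesh i (face i m)"
  shows "tick i k (m k) \<le> x $ k" "x $ k \<le> tick i k (m k + 1)"
  using assms dlo_dhi(1)[of i k m] dlo_dhi(2)[of i m k]
  by (auto simp: dual_cell_face mem_box_cart intro: order_trans)

section \<open>Domain, closure and frontier in terms of present cells\<close>

lemma cell_open_unique:
  assumes "\<And>k. g k (m k) < x $ k" "\<And>k. x $ k < g k (m k + 1)" "x \<in> cell p"
  shows "p = m"
proof
  fix k show "p k = m k"
    using strict_mono_gap_unique[OF grid_mono, of k "m k" "x $ k" "p k"] assms by (auto simp: mem_cell)
qed

lemma open_dom: "open dom"
  by (simp add: dom_def)

lemma mesh_cover_imp_dom:
  assumes "open S" "S \<subseteq> \<Union>mesh" "x \<in> S"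
  shows "x \<in> dom"
  using assms interior_maximal unfolding dom_def by blast

text \<open>A neighbourhood of \<open>x\<close> inside \<open>dom\<close> contains interior points
  of \<open>cell p\<close>; these are covered by the mesh, and no other cell reaches them.\<close>

lemma cell_meets_dom:
  assumes "x \<in> cell p" "x \<in> dom"
  shows "p \<in> A"
proof -
  have "box (\<chi> k. g k (p k)) (\<chi> k. g k (p k + 1)) \<noteq> {}"
    by (simp add: interval_ne_empty_cart)
  then have "closure (box (\<chi> k. g k (p k)) (\<chi> k. g k (p k + 1))) = cell p"
    by (simp add: closure_box cell_def)
  then have "dom \<inter> box (\<chi> k. g k (p k)) (\<chi> k. g k (p k + 1)) \<noteq> {}"
    using assms open_Int_closure_eq_empty[OF open_dom] by blast
  then obtain y where y: "y \<in> dom" "y \<in> box (\<chi> k. g k (p k)) (\<chi> k. g k (p k + 1))" by blast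
  then obtain q where "q \<in> A" "y \<in> cell q"
    using interior_subset unfolding dom_def mesh_def by blast
  then show ?thesis using cell_open_unique[of p y q] y(2) by (simp add: mem_box_cart)
qed

lemma closure_dom: "closure dom = \<Union>mesh"
proof
  have "closed (\<Union>mesh)" using finite_cells by (auto simp: mesh_def cell_def)
  then show "closure dom \<subseteq> \<Union>mesh" unfolding dom_def by (rule closure_minimal[OF interior_subset])
  show "\<Union>mesh \<subseteq> closure dom"
  proof (rule Union_least)
    fix K assume K: "K \<in> mesh"
    then obtain p where p: "K = cell p" by (auto simp: mesh_def)
    have "closure (interior K) = K"
      unfolding p cell_def interior_cbox by (rule closure_box) (simp add: interval_ne_empty_cart)
    moreover have "interior K \<subseteq> dom" unfolding dom_def using K by (intro interior_mono) blast
    ultimately show "K \<subseteq> closure dom" using closure_mono by blast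
  qed
qed

lemma mem_frontier: "x \<in> frontier dom \<longleftrightarrow> x \<in> \<Union>mesh \<and> x \<notin> dom"
  by (simp add: frontier_def closure_dom interior_open open_dom)

text \<open>The face also lies in the absent cell, so \<open>cell_meets_dom\<close> keeps its points
  out of \<open>dom\<close>, while the present cell keeps them in the closure.\<close>

lemma ext_face:
  assumes "is_face i m" "\<not> (m \<in> A \<and> m(i := m i - 1) \<in> A)"
  shows "face i m \<in> ext_faces dom mesh i"
proof -
  have sub: "face i m \<subseteq> cell m" "face i m \<subseteq> cell (m(i := m i - 1))"
    by (auto simp: mem_face mem_cell_at[of _ _ i])
  have "face i m \<subseteq> frontier dom"
  proof
    fix x assume x: "x \<in> face i m"
    then have "x \<notin> dom" using assms(2) sub cell_meets_dom by blast
    moreover have "x \<in> \<Union>mesh" using x sub assms(1) by (auto simp: mesh_def is_face_def)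
    ultimately show "x \<in> frontier dom" by (simp add: mem_frontier)
  qed
  then show ?thesis using assms(1) by (auto simp: ext_faces_def mac_faces_mesh)
qed

end

section \<open>Dual faces meeting a vertex box\<close>

text \<open>This is \<open>face_cell\<close> for a given pair of sides. It separates the geometry,
  valid for every admissible pair, from the arbitrary choice made by \<open>sides\<close>.\<close>

definition side_cell ::
  "'n \<Rightarrow> (real ^ 'n) set \<Rightarrow> (real ^ 'n) set \<Rightarrow> (real ^ 'n) set option \<Rightarrow> (real ^ 'n) set" where
  "side_cell j \<epsilon> \<sigma> N = {x. \<exists>y\<in>\<epsilon>. (\<forall>k. k \<noteq> j \<longrightarrow> x $ k = y $ k) \<and>
     x $ j \<in> closed_segment (centre \<sigma> $ j) (far_point \<epsilon> \<sigma> N $ j)}"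

lemma dual_face_sides:
  assumes "\<epsilon> \<in> dual_faces \<Omega> M i j"
  obtains \<sigma> N where "sides \<Omega> M i j \<epsilon> = (\<sigma>, N)" "dual_face \<Omega> M i j \<epsilon> \<sigma> N"
    "face_cell \<Omega> M i j \<epsilon> = side_cell j \<epsilon> \<sigma> N"
proof -
  obtain \<sigma> N where s: "sides \<Omega> M i j \<epsilon> = (\<sigma>, N)" by (metis surj_pair)
  have "\<exists>p. case p of (\<sigma>, N) \<Rightarrow> dual_face \<Omega> M i j \<epsilon> \<sigma> N"
    using assms by (auto simp: dual_faces_def)
  then have "case sides \<Omega> M i j \<epsilon> of (\<sigma>, N) \<Rightarrow> dual_face \<Omega> M i j \<epsilon> \<sigma> N"
    unfolding sides_def by (rule someI_ex)
  then show thesis using that s by (auto simp: face_cell_def side_cell_def)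
qed

context mac_grid
begin

abbreviation prev :: "'n \<Rightarrow> ('n \<Rightarrow> int) \<Rightarrow> 'n \<Rightarrow> int" where
  "prev j m \<equiv> m(j := m j - 1)"

text \<open>
  Up to null sets, \<open>vbox i j m\<close> is \<open>D\<^sub>\<epsilon>\<close> for the dual face \<open>\<epsilon>\<close> between the faces \<open>m\<close> and \<open>prev j m\<close>
  whenever these have full dual cells near \<open>\<epsilon>\<close>, which is what \<open>full i j m\<close> says. For \<open>i = j\<close> it is the
  interior of the primal cell \<open>prev i m\<close>.
\<close>

definition vbox :: "'n \<Rightarrow> 'n \<Rightarrow> ('n \<Rightarrow> int) \<Rightarrow> (real ^ 'n) set" where
  "vbox i j m = box (\<chi> k. if k = j then ctick i j (m j - 1) else tick i k (m k))
                    (\<chi> k. if k = j then ctick i j (m j) else tick i k (m k + 1))"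

definition full :: "'n \<Rightarrow> 'n \<Rightarrow> ('n \<Rightarrow> int) \<Rightarrow> bool" where
  "full i j m \<longleftrightarrow> (if i = j then prev i m \<in> A
     else m \<in> A \<and> prev i m \<in> A \<and> prev j m \<in> A \<and> prev i (prev j m) \<in> A)"

lemma mem_vbox: "x \<in> vbox i j m \<longleftrightarrow> (ctick i j (m j - 1) < x $ j \<and> x $ j < ctick i j (m j)) \<and>
    (\<forall>k. k \<noteq> j \<longrightarrow> tick i k (m k) < x $ k \<and> x $ k < tick i k (m k + 1))"
  unfolding vbox_def mem_box_cart by (subst all_split_at[of _ j]) auto

lemma open_vbox: "open (vbox i j m)"
  by (simp add: vbox_def open_box)

lemma full_vbox_subset:
  assumes "full i j m"
  shows "vbox i j m \<subseteq> dom"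
proof -
  have "vbox i j m \<subseteq> \<Union>mesh"
  proof
    fix x assume x: "x \<in> vbox i j m"
    show "x \<in> \<Union>mesh"
    proof (cases "i = j")
      case True
      then have "x \<in> cell (prev i m)"
        using x by (auto simp: mem_vbox mem_cell_at[of _ _ i] tick_def ctick_def less_imp_le)
      then show ?thesis using assms True by (auto simp: full_def mesh_def)
    next
      case False
      \<comment> \<open>The cell, among the four around the vertex, in whose quadrant
        \<open>x\<close> lies.\<close>
      define p where "p = (\<lambda>k. if (k = i \<or> k = j) \<and> x $ k < g k (m k) then m k - 1 else m k)"
      have "p = m \<or> p = prev i m \<or> p = prev j m \<or> p = prev i (prev j m)"
        using False by (auto simp: p_def fun_eq_iff)
      then have "p \<in> A" using assms False by (auto simp: full_def)
      moreover have "x \<in> cell p" unfolding mem_cell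
      proof
        fix k
        show "g k (p k) \<le> x $ k \<and> x $ k \<le> g k (p k + 1)"
          using x False mid_between[of k "m k"] mid_between[of k "m k - 1"]
          by (auto simp: p_def mem_vbox tick_def ctick_def split: if_splits) (smt (verit))+
      qed
      ultimately show ?thesis by (auto simp: mesh_def)
    qed
  qed
  then show ?thesis using mesh_cover_imp_dom[OF open_vbox] by blast
qed

text \<open>The open box spanned by both cells is covered by the mesh. This is what excludes points
  of a frontier face later on.\<close>

lemma two_cells_dom:
  assumes "m \<in> A" "prev j m \<in> A" "x $ j = g j (m j)"
    and "\<And>k. k \<noteq> j \<Longrightarrow> g k (m k) < x $ k" "\<And>k. k \<noteq> j \<Longrightarrow> x $ k < g k (m k + 1)"
  shows "x \<in> dom"
proof (rule mesh_cover_imp_dom)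
  let ?S = "box (\<chi> k. g k (prev j m k)) (\<chi> k. g k (m k + 1))"
  show "open ?S" by (rule open_box)
  show "x \<in> ?S" using assms(3-5) by (auto simp: mem_box_cart)
  show "?S \<subseteq> \<Union>mesh"
  proof
    fix y assume y: "y \<in> ?S"
    have "y \<in> cell (if y $ j < g j (m j) then prev j m else m)"
      using y unfolding mem_box_cart mem_cell by (auto simp: less_imp_le) (smt (verit))+
    then show "y \<in> \<Union>mesh" using assms(1,2) by (auto simp: mesh_def split: if_splits)
  qed
qed

text \<open>Off direction \<open>j\<close> the facet has positive extent, and its midpoint forces
  equal indices. Along \<open>j\<close> the two closed gaps share a point, which forces adjacent
  ones.\<close>

lemma dual_cells_overlap:
  assumes "is_face i p" "is_face i q" "p \<noteq> q" "is_facet j S"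
    and S: "S = dual_cell mesh i (face i p) \<inter> dual_cell mesh i (face i q)"
  shows "q = prev j p \<or> p = prev j q"
proof -
  obtain a b where ab: "S = cbox a b" "a $ j = b $ j" "\<And>k. k \<noteq> j \<Longrightarrow> a $ k < b $ k"
    using assms(4) by (auto simp: is_facet_def)
  have le: "a $ k \<le> b $ k" for k using ab(2) ab(3)[of k] by (cases "k = j") auto
  have "a \<in> S" "b \<in> S" using le by (auto simp: ab(1) mem_box_cart)
  then have t: "tick i k (r k) \<le> a $ k" "b $ k \<le> tick i k (r k + 1)" if "r = p \<or> r = q" for r k
    using dual_cell_tick[of i r] that assms(1,2) S by auto
  have eq: "p k = q k" if "k \<noteq> j" for k
    using strict_mono_gap_unique[OF tick_mono, of i k "p k" "(a $ k + b $ k) / 2" "q k"]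
      t[of p k] t[of q k] ab(3)[OF that] by auto
  have "p j \<noteq> q j" using eq assms(3) by (metis ext)
  then have "q j = p j + 1 \<or> p j = q j + 1"
    using strict_mono_gap_adjacent[OF tick_mono, of i j "p j" "a $ j" "q j"]
      strict_mono_gap_adjacent[OF tick_mono, of i j "q j" "a $ j" "p j"]
      t[of p j] t[of q j] ab(2) by (cases "p j < q j") auto
  then show ?thesis using eq by (auto simp: fun_eq_iff)
qed

lemma common_face_cases:
  assumes "common_face mesh i j \<epsilon> \<sigma> \<sigma>'"
  obtains p where "is_face i p" "is_face i (prev j p)"
    "\<epsilon> = dual_cell mesh i (face i p) \<inter> dual_cell mesh i (face i (prev j p))"
    "(\<sigma> = face i p \<and> \<sigma>' = face i (prev j p)) \<or> (\<sigma>' = face i p \<and> \<sigma> = face i (prev j p))"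
proof -
  obtain p q where pq: "\<sigma> = face i p" "\<sigma>' = face i q" "is_face i p" "is_face i q"
    using assms by (auto simp: common_face_def mac_faces_mesh)
  show thesis
    using dual_cells_overlap[of i p q j \<epsilon>] assms pq that[of p] that[of q]
    by (auto simp: common_face_def)
qed

text \<open>Keeps what is used of a boundary face: it lies in one flat side of the dual cell and in
  the frontier, both closed, and so does its closest point to the centre.\<close>

lemma boundary_face_cases:
  assumes "boundary_face dom mesh i j \<epsilon> \<sigma>"
  obtains p t where "is_face i p" "\<sigma> = face i p" "t \<in> {dlo i p j, dhi i p j}"
    "\<epsilon> \<subseteq> dual_cell mesh i (face i p) \<inter> {x. x $ j = t}" "\<epsilon> \<subseteq> frontier dom"
    "far_point \<epsilon> \<sigma> None $ j = t"
proof -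
  obtain p where p: "\<sigma> = face i p" "is_face i p"
    using assms by (auto simp: boundary_face_def mac_faces_mesh)
  obtain F where F: "F \<in> box_faces j (dual_cell mesh i \<sigma>)"
      "\<epsilon> = closure (rel_interior F \<inter> frontier dom)" "\<epsilon> \<noteq> {}"
    using assms by (auto simp: boundary_face_def)
  have "(\<chi> k. dlo i p k) $ k \<le> (\<chi> k. dhi i p k) $ k" for k
    using dlo_dhi(3)[OF p(2), of k] by simp
  then obtain t where t: "t \<in> {dlo i p j, dhi i p j}"
    "F = dual_cell mesh i (face i p) \<inter> {x. x $ j = t}"
    using F(1) unfolding p(1) dual_cell_face[OF p(2)] by (subst (asm) box_faces_cbox) auto
  have "closed F"
    unfolding t dual_cell_face[OF p(2)] by (intro closed_Int closed_cbox closed_Collect_eq continuous_intros)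
  then have sub: "\<epsilon> \<subseteq> F" "\<epsilon> \<subseteq> frontier dom"
    unfolding F(2) using rel_interior_subset[of F] by (intro closure_minimal; auto)+
  moreover have "far_point \<epsilon> \<sigma> None \<in> \<epsilon>"
    unfolding far_point_def using F closest_point_in_set[of \<epsilon>] by auto
  ultimately show thesis
    by (intro that[OF p(2,1) t(1)]) (use t(2) in blast)+
qed

text \<open>Off direction \<open>j\<close> the index is read from the ticks of the dual cells; along
  \<open>j\<close> the cell runs between two consecutive centres, so there it is read from
  \<open>ctick\<close>.\<close>

lemma mem_side_cell_common:
  assumes "common_face mesh i j \<epsilon> \<sigma> \<sigma>'" "x \<in> vbox i j m" "x \<in> side_cell j \<epsilon> \<sigma> (Some \<sigma>')"
  shows "is_face i m" "is_face i (prev j m)"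
    "\<epsilon> = dual_cell mesh i (face i m) \<inter> dual_cell mesh i (face i (prev j m))"
    "(\<sigma> = face i m \<and> \<sigma>' = face i (prev j m)) \<or> (\<sigma>' = face i m \<and> \<sigma> = face i (prev j m))"
proof -
  obtain p where p: "is_face i p" "is_face i (prev j p)"
    "\<epsilon> = dual_cell mesh i (face i p) \<inter> dual_cell mesh i (face i (prev j p))"
    "(\<sigma> = face i p \<and> \<sigma>' = face i (prev j p)) \<or> (\<sigma>' = face i p \<and> \<sigma> = face i (prev j p))"
    using common_face_cases[OF assms(1)] by blast
  obtain y where y: "y \<in> \<epsilon>" "\<And>k. k \<noteq> j \<Longrightarrow> x $ k = y $ k"
      "x $ j \<in> closed_segment (centre \<sigma> $ j) (centre \<sigma>' $ j)"
    using assms(3) by (auto simp: side_cell_def far_point_def)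
  have "p k = m k" if "k \<noteq> j" for k
    using strict_mono_gap_unique[OF tick_mono, of i k "m k" "x $ k" "p k"] assms(2) that y
      dual_cell_tick[OF p(1), of y k] p(3) by (auto simp: mem_vbox)
  moreover have "p j = m j"
  proof -
    have "ctick i j (p j - 1) < ctick i j (p j)" by simp
    then have "ctick i j (p j - 1) \<le> x $ j" "x $ j \<le> ctick i j (p j)"
      using p(4) y(3) by (auto simp: centre_face closed_segment_eq_real_ivl simp del: ctick_less split: if_splits)
    then show ?thesis
      using strict_mono_gap_unique[OF ctick_mono, of i j "m j - 1" "x $ j" "p j - 1"] assms(2)
      by (auto simp: mem_vbox)
  qed
  ultimately have "p = m" by (metis ext)
  then show "is_face i m" "is_face i (prev j m)"
    "\<epsilon> = dual_cell mesh i (face i m) \<inter> dual_cell mesh i (face i (prev j m))"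
    "(\<sigma> = face i m \<and> \<sigma>' = face i (prev j m)) \<or> (\<sigma>' = face i m \<and> \<sigma> = face i (prev j m))"
    using p by blast+
qed

text \<open>The point \<open>y\<close> of \<open>\<epsilon>\<close> on the line through
  \<open>x\<close> in direction \<open>j\<close> stays in the open box and belongs to the
  frontier.\<close>

lemma mem_side_cell_boundary:
  assumes "boundary_face dom mesh i j \<epsilon> \<sigma>" "x \<in> vbox i j m" "x \<in> side_cell j \<epsilon> \<sigma> None"
  shows "\<not> vbox i j m \<subseteq> dom"
    "(is_face i m \<and> \<sigma> = face i m) \<or> (is_face i (prev j m) \<and> \<sigma> = face i (prev j m))"
proof -
  obtain p t where p: "is_face i p" "\<sigma> = face i p" and t: "t \<in> {dlo i p j, dhi i p j}"
    and sub: "\<epsilon> \<subseteq> dual_cell mesh i (face i p) \<inter> {x. x $ j = t}" "\<epsilon> \<subseteq> frontier dom"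
    and far: "far_point \<epsilon> \<sigma> None $ j = t"
    using boundary_face_cases[OF assms(1)] by blast
  obtain y where y: "y \<in> \<epsilon>" "\<And>k. k \<noteq> j \<Longrightarrow> x $ k = y $ k"
      "x $ j \<in> closed_segment (ctick i j (p j)) t"
    using assms(3) unfolding side_cell_def far by (auto simp: p(2) centre_face)
  have pk: "p k = m k" if "k \<noteq> j" for k
    using strict_mono_gap_unique[OF tick_mono, of i k "m k" "x $ k" "p k"] assms(2) that y
      dual_cell_tick[OF p(1), of y k] sub(1) by (auto simp: mem_vbox)
  have xj: "ctick i j (m j - 1) < x $ j" "x $ j < ctick i j (m j)"
    using assms(2) by (auto simp: mem_vbox)
  note tc = tick_ctick[of i j "p j"] tick_ctick[of i j "p j - 1"] tick_ctick[of i j "p j + 1"]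
  have gap: "r = m j - 1" if "ctick i j r \<le> x $ j" "x $ j \<le> ctick i j (r + 1)" for r
    using strict_mono_gap_unique[OF ctick_mono, of i j "m j - 1" "x $ j" r] xj that by simp
  \<comment> \<open>The first case is an exterior face with \<open>i = j\<close>, whose dual cell
    stops at the face: the segment is then a single point, which the open box avoids.\<close>
  have "t = ctick i j (p j) \<or> t = tick i j (p j) \<or> t = tick i j (p j + 1)"
    using t by (auto simp: dlo_def dhi_def ctick_def)
  then have "(t = tick i j (p j) \<and> p j = m j) \<or> (t = tick i j (p j + 1) \<and> p j = m j - 1)"
  proof (elim disjE)
    assume "t = ctick i j (p j)"
    then have "x $ j = ctick i j (p j)" using y(3) by simp
    then show ?thesis using xj by simp
  next
    assume "t = tick i j (p j)"
    then show ?thesis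
      using y(3) tc gap[of "p j - 1"] by (auto simp: closed_segment_eq_real_ivl split: if_splits)
  next
    assume "t = tick i j (p j + 1)"
    then show ?thesis
      using y(3) tc gap[of "p j"] by (auto simp: closed_segment_eq_real_ivl split: if_splits)
  qed
  then have *: "t = tick i j (m j)" "p = m \<or> p = prev j m"
    using pk by (auto simp: fun_eq_iff) metis+
  have "y $ j = tick i j (m j)" using y(1) sub(1) *(1) by auto
  then have "y \<in> vbox i j m"
    using assms(2) y(2) tick_ctick[of i j "m j"] tick_ctick[of i j "m j - 1"] by (auto simp: mem_vbox)
  then show "\<not> vbox i j m \<subseteq> dom" using sub(2) y(1) mem_frontier by blast
  show "(is_face i m \<and> \<sigma> = face i m) \<or> (is_face i (prev j m) \<and> \<sigma> = face i (prev j m))"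
    using *(2) p by blast
qed

text \<open>Guards against the convention that a sum over an infinite set is zero. Each dual face is
  an intersection of two dual cells or is cut from a side of one.\<close>

lemma finite_dual_faces: "finite (dual_faces dom mesh i j)"
proof -
  let ?F = "mac_faces mesh i"
  let ?S = "(\<lambda>(\<sigma>, \<sigma>'). dual_cell mesh i \<sigma> \<inter> dual_cell mesh i \<sigma>') ` (?F \<times> ?F) \<union>
     (\<lambda>F. closure (rel_interior F \<inter> frontier dom)) ` (\<Union>\<sigma>\<in>?F. box_faces j (dual_cell mesh i \<sigma>))"
  have "dual_faces dom mesh i j \<subseteq> ?S"
    by (auto simp: dual_faces_def dual_face_def common_face_def boundary_face_def split: option.splits)
  moreover have "finite ?S" using finite_faces by (auto simp: box_faces_def)
  ultimately show ?thesis by (rule finite_subset)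
qed

text \<open>The centre of a dual cell, even a truncated one, lies strictly between the ticks, so no
  other dual cell contains it; the single remaining term carries the coefficient of an exterior
  face.\<close>

lemma coef_ext:
  assumes "u \<in> mac_space dom mesh" "is_face i p" "\<not> (p \<in> A \<and> prev i p \<in> A)"
  shows "coef mesh u i (face i p) = 0"
proof -
  obtain v where v: "\<forall>\<sigma>\<in>ext_faces dom mesh i. v \<sigma> = 0"
    "(\<lambda>x. u x $ i) = (\<lambda>x. \<Sum>\<sigma>\<in>mac_faces mesh i. v \<sigma> * indicator (interior (dual_cell mesh i \<sigma>)) x)"
    using assms(1) by (auto simp: mac_space_def mac_component_space_def)
  define z where "z = centre (dual_cell mesh i (face i p))"
  have lt: "dlo i p k < dhi i p k" for k by (rule dlo_dhi(3)[OF assms(2)])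
  have z: "z $ k = (dlo i p k + dhi i p k) / 2" for k
    unfolding z_def dual_cell_face[OF assms(2)] using lt
    by (subst centre_cbox_cart) (auto simp: less_imp_le)
  have "v \<sigma> * indicator (interior (dual_cell mesh i \<sigma>)) z = 0" if \<sigma>: "\<sigma> \<in> mac_faces mesh i" for \<sigma>
  proof (cases "z \<in> interior (dual_cell mesh i \<sigma>)")
    case True
    obtain q where q: "\<sigma> = face i q" "is_face i q" using \<sigma> by (auto simp: mac_faces_mesh)
    have zq: "z \<in> dual_cell mesh i (face i q)" using True interior_subset unfolding q by blast
    have "q k = p k" for k
    proof (rule strict_mono_gap_unique[OF tick_mono])
      show "tick i k (p k) < z $ k" "z $ k < tick i k (p k + 1)"
        using lt[of k] dlo_dhi(1)[of i k p] dlo_dhi(2)[of i p k] unfolding z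
        by (simp_all only: field_simps)
      show "tick i k (q k) \<le> z $ k" "z $ k \<le> tick i k (q k + 1)"
        using dual_cell_tick[OF q(2) zq] by auto
    qed
    then have "q = p" by auto
    then show ?thesis using v(1) ext_face[OF assms(2,3)] q by auto
  qed simp
  then have "u z $ i = 0" using fun_cong[OF v(2), of z] by (simp add: sum.neutral)
  then show ?thesis by (simp add: coef_def z_def)
qed

text \<open>The extension by zero to all indices, where \<open>coef\<close> would be meaningless for
  those that are not faces.\<close>

definition inner_coef :: "(real ^ 'n \<Rightarrow> real ^ 'n) \<Rightarrow> 'n \<Rightarrow> ('n \<Rightarrow> int) \<Rightarrow> real" where
  "inner_coef u i m = (if m \<in> A \<and> prev i m \<in> A then coef mesh u i (face i m) else 0)"

lemma coef_face:
  assumes "u \<in> mac_space dom mesh" "is_face i p"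
  shows "coef mesh u i (face i p) = inner_coef u i p"
  using coef_ext[OF assms] by (auto simp: inner_coef_def)

text \<open>Every dual face whose cell reaches the box uses only the coefficients of
  \<open>m\<close> and \<open>prev j m\<close>, whatever its shape.\<close>

lemma discrete_deriv_zero:
  assumes "u \<in> mac_space dom mesh" "x \<in> vbox i j m"
    and "inner_coef u i m = 0" "inner_coef u i (prev j m) = 0"
  shows "discrete_deriv dom mesh i j u x = 0"
  unfolding discrete_deriv_def
proof (rule sum.neutral, rule ballI)
  fix \<epsilon> assume \<epsilon>: "\<epsilon> \<in> dual_faces dom mesh i j"
  obtain \<sigma> N where s: "sides dom mesh i j \<epsilon> = (\<sigma>, N)" "dual_face dom mesh i j \<epsilon> \<sigma> N"
    "face_cell dom mesh i j \<epsilon> = side_cell j \<epsilon> \<sigma> N"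
    using dual_face_sides[OF \<epsilon>] by blast
  show "deriv_coef dom mesh i j u \<epsilon> * indicator (interior (face_cell dom mesh i j \<epsilon>)) x = 0"
  proof (cases "x \<in> side_cell j \<epsilon> \<sigma> N")
    case True
    have "deriv_coef dom mesh i j u \<epsilon> = 0"
    proof (cases N)
      case None
      then have "boundary_face dom mesh i j \<epsilon> \<sigma>" using s(2) by (simp add: dual_face_def)
      then have "coef mesh u i \<sigma> = 0"
        using mem_side_cell_boundary(2)[of i j \<epsilon> \<sigma> x m] assms True None coef_face[OF assms(1)] by auto
      then show ?thesis using s(1) None by (simp add: deriv_coef_def)
    next
      case (Some \<sigma>')
      then have "common_face mesh i j \<epsilon> \<sigma> \<sigma>'" using s(2) by (simp add: dual_face_def)
      then have "coef mesh u i \<sigma> = 0" "coef mesh u i \<sigma>' = 0"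
        using mem_side_cell_common[of i j \<epsilon> \<sigma> \<sigma>' x m] assms True Some coef_face[OF assms(1)] by auto
      then show ?thesis using s(1) Some by (simp add: deriv_coef_def)
    qed
    then show ?thesis by simp
  next
    case False
    then have "x \<notin> interior (face_cell dom mesh i j \<epsilon>)" using s(3) interior_subset by blast
    then show ?thesis by simp
  qed
qed

end

section \<open>Discrete derivatives on vertex boxes\<close>

context mac_grid
begin

lemma full_is_face:
  assumes "full i j m"
  shows "is_face i m" "is_face i (prev j m)"
  using assms by (auto simp: full_def is_face_def fun_upd_twist split: if_splits)

text \<open>For \<open>i = j\<close> the far ends \<open>dhi i m j\<close> and
  \<open>dlo i (prev j m) j\<close> may still be truncated, so only the ends meeting at the dual
  face are determined.\<close>

lemma full_dual_face_bounds:
  assumes "full i j m"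
  shows "k \<noteq> j \<Longrightarrow> dlo i m k = tick i k (m k)" "k \<noteq> j \<Longrightarrow> dhi i m k = tick i k (m k + 1)"
    "k \<noteq> j \<Longrightarrow> dlo i (prev j m) k = tick i k (m k)" "k \<noteq> j \<Longrightarrow> dhi i (prev j m) k = tick i k (m k + 1)"
    "dlo i m j = tick i j (m j)" "dhi i (prev j m) j = tick i j (m j)"
  using assms by (auto simp: full_def dlo_def dhi_def fun_upd_twist split: if_splits)

definition dface :: "'n \<Rightarrow> 'n \<Rightarrow> ('n \<Rightarrow> int) \<Rightarrow> (real ^ 'n) set" where
  "dface i j m = dual_cell mesh i (face i m) \<inter> dual_cell mesh i (face i (prev j m))"

lemma mem_dface:
  assumes "full i j m"
  shows "x \<in> dface i j m \<longleftrightarrow> x $ j = tick i j (m j) \<and>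
    (\<forall>k. k \<noteq> j \<longrightarrow> tick i k (m k) \<le> x $ k \<and> x $ k \<le> tick i k (m k + 1))"
proof -
  have "tick i j (m j) \<le> dhi i m j" "dlo i (prev j m) j \<le> tick i j (m j)"
    using dlo_dhi(3)[OF full_is_face(1)[OF assms], of j] dlo_dhi(3)[OF full_is_face(2)[OF assms], of j]
    by (auto simp: full_dual_face_bounds[OF assms])
  then show ?thesis
    unfolding dface_def dual_cell_face[OF full_is_face(1)[OF assms]]
      dual_cell_face[OF full_is_face(2)[OF assms]] Int_iff mem_box_cart
      all_split_at[of "\<lambda>k. _ $ k \<le> x $ k \<and> x $ k \<le> _ $ k" j]
    by (auto simp: full_dual_face_bounds[OF assms])
qed

lemma dist_centre_faces:
  "dist (centre (face i m)) (centre (face i (prev j m))) = ctick i j (m j) - ctick i j (m j - 1)"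
proof -
  have "centre (face i m) - centre (face i (prev j m)) =
      (ctick i j (m j) - ctick i j (m j - 1)) *\<^sub>R axis j 1"
    by (auto simp: vec_eq_iff centre_face axis_def)
  moreover have "ctick i j (m j - 1) < ctick i j (m j)" by simp
  ultimately show ?thesis by (simp add: dist_norm del: ctick_less)
qed

lemma dface_dual_face:
  assumes "full i j m"
  shows "dual_face dom mesh i j (dface i j m) (face i m) (Some (face i (prev j m)))"
proof -
  have "dface i j m = cbox (\<chi> k. tick i k (m k)) (\<chi> k. if k = j then tick i j (m j) else tick i k (m k + 1))"
    (is "_ = cbox ?a ?b")
  proof (rule set_eqI)
    fix x
    show "x \<in> dface i j m \<longleftrightarrow> x \<in> cbox ?a ?b"
      unfolding mem_dface[OF assms] mem_box_cart all_split_at[of "\<lambda>k. ?a $ k \<le> x $ k \<and> x $ k \<le> ?b $ k" j]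
      by auto
  qed
  then have "is_facet j (dface i j m)"
    unfolding is_facet_def by (intro exI[of _ ?a] exI[of _ ?b]) simp
  moreover have "m \<noteq> prev j m" by (simp add: fun_eq_iff)
  moreover have "0 < dist (centre (face i m)) (centre (face i (prev j m)))"
    unfolding dist_centre_faces by simp
  ultimately show ?thesis
    using full_is_face[OF assms]
    by (simp add: dual_face_def common_face_def far_point_def mac_faces_mesh dface_def)
qed

text \<open>The centre \<open>y\<close> of the dual face lies in \<open>dom\<close>, which excludes
  a boundary face, and its coordinates determine the index of a common face. Only the order of the
  two sides stays open.\<close>

lemma dface_sides:
  assumes "full i j m" "dual_face dom mesh i j (dface i j m) \<sigma> N"
  shows "(\<sigma> = face i m \<and> N = Some (face i (prev j m))) \<or> (\<sigma> = face i (prev j m) \<and> N = Some (face i m))"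
proof -
  define y :: "real ^ 'n" where
    "y = (\<chi> k. if k = j then tick i j (m j) else (tick i k (m k) + tick i k (m k + 1)) / 2)"
  have lt: "tick i k (m k) < tick i k (m k + 1)" for k by simp
  have y_mid: "tick i k (m k) < y $ k" "y $ k < tick i k (m k + 1)" if "k \<noteq> j" for k
    using lt[of k] that by (auto simp: y_def field_simps simp del: tick_less)
  have y: "y \<in> dface i j m" unfolding mem_dface[OF assms(1)]
    using y_mid by (auto simp: less_imp_le) (simp add: y_def)
  have "y \<in> vbox i j m" unfolding mem_vbox
    using y_mid tick_ctick(1)[of i j "m j"] tick_ctick(2)[of i j "m j - 1"] by (auto simp: y_def)
  then have "y \<in> dom" using full_vbox_subset[OF assms(1)] by blast
  show ?thesis
  proof (cases N)
    case None
    then have "boundary_face dom mesh i j (dface i j m) \<sigma>" using assms(2) by (simp add: dual_face_def)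
    then have "y \<in> frontier dom" using y by (elim boundary_face_cases) blast
    then show ?thesis using \<open>y \<in> dom\<close> by (simp add: mem_frontier)
  next
    case (Some \<sigma>')
    then have "common_face mesh i j (dface i j m) \<sigma> \<sigma>'" using assms(2) by (simp add: dual_face_def)
    then obtain p where p: "is_face i p" "is_face i (prev j p)"
      "dface i j m = dual_cell mesh i (face i p) \<inter> dual_cell mesh i (face i (prev j p))"
      "(\<sigma> = face i p \<and> \<sigma>' = face i (prev j p)) \<or> (\<sigma>' = face i p \<and> \<sigma> = face i (prev j p))"
      by (rule common_face_cases)
    have "p k = m k" if "k \<noteq> j" for k
      using strict_mono_gap_unique[OF tick_mono, of i k "m k" "y $ k" "p k"] y_mid that y
        dual_cell_tick[OF p(1), of y k] p(3) by auto
    moreover have "p j = m j"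
    proof -
      have "tick i j (p j) \<le> y $ j" "y $ j \<le> tick i j (p j)"
        using dual_cell_tick(1)[OF p(1), of y j] dual_cell_tick(2)[OF p(2), of y j] y p(3) by auto
      then show ?thesis by (simp add: y_def)
    qed
    ultimately have "p = m" by (metis ext)
    then show ?thesis using p(4) Some by blast
  qed
qed

lemma vbox_face_cell:
  assumes "full i j m"
  shows "vbox i j m \<subseteq> face_cell dom mesh i j (dface i j m)"
proof
  fix x assume x: "x \<in> vbox i j m"
  have "dface i j m \<in> dual_faces dom mesh i j"
    using dface_dual_face[OF assms] by (auto simp: dual_faces_def)
  then obtain \<sigma> N where s: "dual_face dom mesh i j (dface i j m) \<sigma> N"
    "face_cell dom mesh i j (dface i j m) = side_cell j (dface i j m) \<sigma> N"
    using dual_face_sides by blast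
  define y where "y = (\<chi> k. if k = j then tick i j (m j) else x $ k)"
  have "y \<in> dface i j m" unfolding mem_dface[OF assms] using x by (auto simp: y_def mem_vbox less_imp_le)
  moreover have "ctick i j (m j - 1) < ctick i j (m j)" by simp
  then have "x $ j \<in> closed_segment (centre \<sigma> $ j) (far_point (dface i j m) \<sigma> N $ j)"
    using dface_sides[OF assms s(1)] x
    by (auto simp: far_point_def centre_face closed_segment_eq_real_ivl mem_vbox simp del: ctick_less)
  ultimately show "x \<in> face_cell dom mesh i j (dface i j m)"
    unfolding s(2) side_cell_def by (auto simp: y_def intro!: bexI[of _ y])
qed

text \<open>Exchanging the sides reverses both the difference and the normal.\<close>

lemma deriv_coef_dface:
  assumes "u \<in> mac_space dom mesh" "full i j m"
  shows "deriv_coef dom mesh i j u (dface i j m) =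
    (inner_coef u i m - inner_coef u i (prev j m)) / (ctick i j (m j) - ctick i j (m j - 1))"
proof -
  have "dface i j m \<in> dual_faces dom mesh i j"
    using dface_dual_face[OF assms(2)] by (auto simp: dual_faces_def)
  then obtain \<sigma> N where s: "sides dom mesh i j (dface i j m) = (\<sigma>, N)"
    "dual_face dom mesh i j (dface i j m) \<sigma> N"
    using dual_face_sides by blast
  note f = full_is_face[OF assms(2)]
  have ub: "interval_upperbound (dual_cell mesh i (face i p)) $ j = dhi i p j" if "is_face i p" for p
  proof -
    have "cbox (\<chi> k. dlo i p k) (\<chi> k. dhi i p k) \<noteq> {}"
      using dlo_dhi(3)[OF that] by (simp add: interval_ne_empty_cart less_imp_le)
    then show ?thesis unfolding dual_cell_face[OF that] by (simp add: interval_bounds')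
  qed
  \<comment> \<open>A corner of the dual face that misses the upper side of the dual cell of
    \<open>m\<close>, so that \<open>outer_normal\<close> takes its negative value there.\<close>
  define y :: "real ^ 'n" where "y = (\<chi> k. tick i k (m k))"
  have "y \<in> dface i j m" unfolding mem_dface[OF assms(2)] by (simp add: y_def)
  moreover have "tick i j (m j) < dhi i m j"
    using dlo_dhi(3)[OF f(1), of j] by (simp add: full_dual_face_bounds[OF assms(2)])
  ultimately have "\<not> dface i j m \<subseteq> {x. x $ j = dhi i m j}" by (auto simp: y_def)
  then have n1: "outer_normal j (dual_cell mesh i (face i m)) (dface i j m) = - axis j 1"
    by (simp add: outer_normal_def ub[OF f(1)])
  have "dface i j m \<subseteq> {x. x $ j = dhi i (prev j m) j}"
    by (auto simp: mem_dface[OF assms(2)] full_dual_face_bounds[OF assms(2)])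
  then have n2: "outer_normal j (dual_cell mesh i (face i (prev j m))) (dface i j m) = axis j 1"
    by (simp add: outer_normal_def ub[OF f(2)])
  show ?thesis
    using dface_sides[OF assms(2) s(2)]
  proof (elim disjE conjE)
    assume "\<sigma> = face i m" "N = Some (face i (prev j m))"
    then show ?thesis
      using s(1) by (simp add: deriv_coef_def d_face_def far_point_def dist_centre_faces n1
          coef_face[OF assms(1)] f inner_axis_axis minus_divide_left)
  next
    assume "\<sigma> = face i (prev j m)" "N = Some (face i m)"
    then show ?thesis
      using s(1) by (simp add: deriv_coef_def d_face_def far_point_def dist_centre_faces n2
          coef_face[OF assms(1)] f inner_axis_axis dist_commute[of "centre (face i (prev j m))"])
  qed
qed

text \<open>A single term survives: boundary faces are excluded because the box lies in
  \<open>dom\<close>, and other common faces because the box determines the face.\<close>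

lemma discrete_deriv_full:
  assumes "u \<in> mac_space dom mesh" "full i j m" "x \<in> vbox i j m"
  shows "discrete_deriv dom mesh i j u x =
    (inner_coef u i m - inner_coef u i (prev j m)) / (ctick i j (m j) - ctick i j (m j - 1))"
proof -
  let ?t = "\<lambda>\<epsilon>. deriv_coef dom mesh i j u \<epsilon> * indicator (interior (face_cell dom mesh i j \<epsilon>)) x"
  have mem: "dface i j m \<in> dual_faces dom mesh i j"
    using dface_dual_face[OF assms(2)] by (auto simp: dual_faces_def)
  have "?t \<epsilon> = 0" if \<epsilon>: "\<epsilon> \<in> dual_faces dom mesh i j - {dface i j m}" for \<epsilon>
  proof -
    obtain \<sigma> N where s: "dual_face dom mesh i j \<epsilon> \<sigma> N"
      "face_cell dom mesh i j \<epsilon> = side_cell j \<epsilon> \<sigma> N"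
      using dual_face_sides \<epsilon> by (metis DiffD1)
    have "x \<notin> side_cell j \<epsilon> \<sigma> N"
    proof
      assume x: "x \<in> side_cell j \<epsilon> \<sigma> N"
      show False
      proof (cases N)
        case None
        then show False
          using mem_side_cell_boundary(1)[OF _ assms(3)] s(1) x full_vbox_subset[OF assms(2)]
          by (auto simp: dual_face_def)
      next
        case (Some \<sigma>')
        then have "\<epsilon> = dface i j m"
          using mem_side_cell_common(3)[OF _ assms(3)] s(1) x by (auto simp: dual_face_def dface_def)
        then show False using \<epsilon> by blast
      qed
    qed
    then have "x \<notin> interior (face_cell dom mesh i j \<epsilon>)" using s(2) interior_subset by blast
    then show ?thesis by simp
  qed
  then have "discrete_deriv dom mesh i j u x = ?t (dface i j m)"
    unfolding discrete_deriv_def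
    by (subst sum.remove[OF finite_dual_faces mem]) (simp add: sum.neutral)
  moreover have "x \<in> interior (face_cell dom mesh i j (dface i j m))"
    using interior_maximal[OF vbox_face_cell[OF assms(2)] open_vbox] assms(3) by blast
  ultimately show ?thesis by (simp add: deriv_coef_dface[OF assms(1,2)])
qed

end

section \<open>Absence of reentrant corners\<close>

lemma rel_interior_flat_box:
  fixes a b y :: "real ^ 'n"
  assumes "y $ j = c" "\<And>k. k \<noteq> j \<Longrightarrow> a $ k < y $ k \<and> y $ k < b $ k" "a $ j \<le> c" "c \<le> b $ j"
  shows "y \<in> rel_interior (cbox a b \<inter> {x. x $ j = c})"
proof -
  let ?F = "cbox a b \<inter> {x. x $ j = c}"
  \<comment> \<open>Thickening in direction \<open>j\<close> makes the flat box open; the hyperplane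
    containing the affine hull cuts it back. The thickness 1 is arbitrary.\<close>
  let ?T = "box (\<chi> k. if k = j then c - 1 else a $ k) (\<chi> k. if k = j then c + 1 else b $ k)"
  have "?F \<subseteq> {x. axis j 1 \<bullet> x = c}" by (auto simp: inner_axis')
  then have hull: "affine hull ?F \<subseteq> {x. axis j 1 \<bullet> x = c}"
    using affine_hyperplane hull_minimal by blast
  have "x \<in> ?F" if "x \<in> ?T" "x $ j = c" for x
  proof -
    have "a $ k \<le> x $ k \<and> x $ k \<le> b $ k" for k
      using that assms(3,4) by (cases "k = j") (auto simp: mem_box_cart less_imp_le dest: spec[of _ k])
    then show ?thesis using that(2) by (simp add: mem_box_cart)
  qed
  then have "?T \<inter> affine hull ?F \<subseteq> ?F" using hull by (auto simp: inner_axis')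
  moreover have "y \<in> ?T" using assms(1,2) by (auto simp: mem_box_cart)
  moreover have "a $ k \<le> y $ k \<and> y $ k \<le> b $ k" for k
    using assms by (cases "k = j") (auto simp: less_imp_le)
  then have "y \<in> ?F" using assms(1) by (simp add: mem_box_cart)
  ultimately show ?thesis unfolding mem_rel_interior using open_box by blast
qed

context mac_grid
begin

text \<open>A dual cell stops at its face where the neighbour is absent, so a point strictly beyond
  the face reveals that neighbour: the upper one for \<open>s = 0\<close>, the lower one for
  \<open>s = 1\<close>.\<close>

lemma dual_cell_side:
  assumes "is_face i p" "x \<in> dual_cell mesh i (face i p)" "s = 0 \<or> s = 1"
    and "g i (p i - s) < x $ i" "x $ i < g i (p i - s + 1)"
  shows "p(i := p i - s) \<in> A"
proof -
  have "dlo i p i \<le> x $ i" "x $ i \<le> dhi i p i"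
    using assms(1,2) by (auto simp: dual_cell_face mem_box_cart)
  then show ?thesis using assms(3-5) by (auto simp: dlo_def dhi_def split: if_splits)
qed

definition corner :: "'n \<Rightarrow> 'n \<Rightarrow> ('n \<Rightarrow> int) \<Rightarrow> int \<Rightarrow> int \<Rightarrow> ('n \<Rightarrow> int)" where
  "corner i j m a b = m(i := m i - a, j := m j - b)"

text \<open>
  With one of the four cells around \<open>m\<close> missing, take the dual face \<open>\<epsilon>\<close> of kind \<open>(i,j)\<close> lying on the
  boundary of the missing cell. Its \<open>D\<^sub>\<epsilon>\<close> contains the point \<open>pt (w s) z\<close> but not its neighbour
  \<open>pt (w (1 - s)) z\<close> across the hyperplane through \<open>m\<close> orthogonal to \<open>e\<^sub>i\<close>, whereas a cell of kind
  \<open>(j,i)\<close> containing the former contains the latter, since both cells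
  \<open>corner i j m _ r\<close> are present.
\<close>

lemma no_reentrant_corner:
  assumes coincide: "dual_partitions_coincide dom mesh" and ij: "i \<noteq> j"
    and r: "r = 0 \<or> r = 1" and s: "s = 0 \<or> s = 1"
    and row: "corner i j m 0 r \<in> A" "corner i j m 1 r \<in> A"
    and other: "corner i j m (1 - s) (1 - r) \<in> A"
  shows "corner i j m s (1 - r) \<in> A"
proof (rule ccontr)
  assume missing: "corner i j m s (1 - r) \<notin> A"
  \<comment> \<open>\<open>w 0\<close> and \<open>w 1\<close> lie on opposite sides of the
    hyperplane through \<open>m\<close> and both within the middle dual gap of direction
    \<open>i\<close>; \<open>z\<close> lies between that row's centre and the vertex, on the side of
    row \<open>r\<close>.\<close>
  define w where "w b = (g i (m i) + mid i (m i - b)) / 2" for b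
  define z where "z = (g j (m j) + mid j (m j - r)) / 2"
  define pt where "pt a b = ((\<chi> k. if k = i then a else if k = j then b else mid k (m k)) :: real ^ 'n)" for a b
  have pt [simp]: "pt a b $ i = a" "pt a b $ j = b" "k \<noteq> i \<Longrightarrow> k \<noteq> j \<Longrightarrow> pt a b $ k = mid k (m k)" for a b k
    using ij by (auto simp: pt_def)
  have w_mid: "mid i (m i - 1) < w b" "w b < mid i (m i)"
    and w_grid: "g i (m i - b) < w b" "w b < g i (m i - b + 1)" if "b = 0 \<or> b = 1" for b
    using that mid_between[of i "m i"] mid_between[of i "m i - 1"] by (auto simp: w_def field_simps)
  have z_grid: "g j (m j - r) < z" "z < g j (m j - r + 1)"
    using r mid_between[of j "m j"] mid_between[of j "m j - 1"] by (auto simp: z_def field_simps)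
  have z_seg: "z \<in> closed_segment (mid j (m j - r)) (g j (m j))"
    by (auto simp: z_def closed_segment_eq_real_ivl field_simps)
  have s': "1 - s = 0 \<or> 1 - s = 1" using s by auto
  \<comment> \<open>The projection of \<open>pt (w s) z\<close> onto the face between the present
    cell \<open>corner i j m s r\<close> and the missing one.\<close>
  define y where "y = pt (w s) (g j (m j))"
  define q where "q = m(j := m j - r)"
  define F where "F = dual_cell mesh i (face i q) \<inter> {x. x $ j = g j (m j)}"
  define \<epsilon> where eps_def: "\<epsilon> = closure (rel_interior F \<inter> frontier dom)"

  have qA: "q \<in> A" "prev i q \<in> A"
    using row ij by (auto simp: q_def corner_def fun_upd_twist)
  then have face_q: "is_face i q" by (simp add: is_face_def)
  have bd: "dlo i q i = mid i (m i - 1)" "dhi i q i = mid i (m i)"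
      "dlo i q j = g j (m j - r)" "dhi i q j = g j (m j - r + 1)"
      "\<And>k. k \<noteq> i \<Longrightarrow> k \<noteq> j \<Longrightarrow> dlo i q k = g k (m k)" "\<And>k. k \<noteq> i \<Longrightarrow> k \<noteq> j \<Longrightarrow> dhi i q k = g k (m k + 1)"
    using qA ij by (auto simp: dlo_def dhi_def tick_def q_def)
  have F_face: "F \<in> box_faces j (dual_cell mesh i (face i q))"
    unfolding F_def dual_cell_face[OF face_q] using dlo_dhi(3)[OF face_q] r
    by (subst box_faces_cbox) (auto simp: less_imp_le bd)
  have y_cell: "y \<in> cell (corner i j m s b)" if "b = 0 \<or> b = 1" for b
    unfolding mem_cell
  proof
    fix k show "g k (corner i j m s b k) \<le> y $ k \<and> y $ k \<le> g k (corner i j m s b k + 1)"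
      using that w_grid[OF s] mid_between[of k "m k"] ij
      by (cases "k = i"; cases "k = j") (auto simp: corner_def y_def less_imp_le)
  qed
  have "corner i j m s r \<in> A" using row s by auto
  then have "y \<in> \<Union>mesh" using y_cell[OF r] by (auto simp: mesh_def)
  moreover have "y \<notin> dom" using cell_meets_dom[OF y_cell[of "1 - r"]] missing r by auto
  ultimately have "y \<in> frontier dom" by (simp add: mem_frontier)
  moreover have "y \<in> rel_interior F"
    unfolding F_def dual_cell_face[OF face_q]
  proof (rule rel_interior_flat_box)
    show "y $ j = g j (m j)" by (simp add: y_def)
    show "(\<chi> k. dlo i q k) $ j \<le> g j (m j)" "g j (m j) \<le> (\<chi> k. dhi i q k) $ j"
      using r by (auto simp: bd)
    fix k assume "k \<noteq> j"
    then show "(\<chi> k. dlo i q k) $ k < y $ k \<and> y $ k < (\<chi> k. dhi i q k) $ k"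
      using w_mid[OF s] mid_between[of k "m k"] by (cases "k = i") (auto simp: bd y_def)
  qed
  ultimately have y_eps: "y \<in> \<epsilon>" unfolding eps_def using closure_subset by blast
  have "closed F"
    unfolding F_def dual_cell_face[OF face_q] by (intro closed_Int closed_cbox closed_Collect_eq continuous_intros)
  then have eps_sub: "\<epsilon> \<subseteq> F" "\<epsilon> \<subseteq> frontier dom"
    unfolding eps_def using rel_interior_subset[of F] by (intro closure_minimal; auto)+
  have bface: "boundary_face dom mesh i j \<epsilon> (face i q)"
    using F_face y_eps face_q by (auto simp: boundary_face_def mac_faces_mesh eps_def)
  have far: "far_point \<epsilon> \<sigma> None $ j = g j (m j)" for \<sigma>
  proof -
    have "closed \<epsilon>" by (simp add: eps_def)
    then have "closest_point \<epsilon> (centre \<sigma>) \<in> \<epsilon>"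
      using y_eps closest_point_in_set by blast
    then have "closest_point \<epsilon> (centre \<sigma>) \<in> F" using eps_sub(1) by blast
    then show ?thesis by (simp add: far_point_def F_def)
  qed
  have "centre (face i q) $ j \<noteq> far_point \<epsilon> (face i q) None $ j"
    using far mid_between[of j "m j"] mid_between[of j "m j - 1"] r ij
    by (auto simp: centre_face ctick_def q_def)
  then have "dual_face dom mesh i j \<epsilon> (face i q) None"
    using bface by (auto simp: dual_face_def)
  then have eps_mem: "\<epsilon> \<in> dual_faces dom mesh i j" by (auto simp: dual_faces_def)

  obtain \<sigma> N where \<sigma>: "dual_face dom mesh i j \<epsilon> \<sigma> N" "face_cell dom mesh i j \<epsilon> = side_cell j \<epsilon> \<sigma> N"
    using dual_face_sides[OF eps_mem] by metis
  have y_gap: "tick i k (m k) < y $ k" "y $ k < tick i k (m k + 1)" if "k \<noteq> j" for k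
    using that w_mid[OF s] mid_between[of k "m k"] by (cases "k = i"; auto simp: y_def tick_def)+
  have index_off: "p k = m k" if "is_face i p" "y \<in> dual_cell mesh i (face i p)" "k \<noteq> j" for p k
    using strict_mono_gap_unique[OF tick_mono y_gap[OF that(3)]] dual_cell_tick[OF that(1,2)] by blast
  \<comment> \<open>A dual cell of the other row that reaches \<open>y\<close> would contain part of
    the missing cell.\<close>
  have row_r: "b = r" if "b = 0 \<or> b = 1" "is_face i (m(j := m j - b))"
      "y \<in> dual_cell mesh i (face i (m(j := m j - b)))" for b
  proof -
    have "(m(j := m j - b))(i := (m(j := m j - b)) i - s) \<in> A"
      by (rule dual_cell_side[OF that(2,3) s]) (use w_grid[OF s] ij in \<open>auto simp: y_def\<close>)
    then have "corner i j m s b \<in> A" using ij by (simp add: corner_def fun_upd_twist)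
    then show ?thesis using missing that(1) r by auto
  qed
  \<comment> \<open>\<open>face_cell\<close> depends on the choice made by \<open>sides\<close>, so
    that choice has to be determined for \<open>\<epsilon>\<close>.\<close>
  have \<sigma>_eq: "N = None" "\<sigma> = face i q"
  proof -
    show N: "N = None"
    proof (rule ccontr)
      assume "N \<noteq> None"
      then obtain \<sigma>' where "common_face mesh i j \<epsilon> \<sigma> \<sigma>'" using \<sigma>(1) by (auto simp: dual_face_def)
      then obtain p where p: "is_face i p" "is_face i (prev j p)"
        "\<epsilon> = dual_cell mesh i (face i p) \<inter> dual_cell mesh i (face i (prev j p))"
        by (rule common_face_cases)
      have yp: "y \<in> dual_cell mesh i (face i p)" "y \<in> dual_cell mesh i (face i (prev j p))"
        using y_eps p(3) by auto
      have "p j = m j"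
        using dual_cell_tick(1)[OF p(1) yp(1), of j] dual_cell_tick(2)[OF p(2) yp(2), of j] ij
        by (simp add: y_def tick_def)
      then have "p = m" using index_off[OF p(1) yp(1)] by (metis ext)
      then show False using row_r[of 0] row_r[of 1] p(1,2) yp by auto
    qed
    then have "boundary_face dom mesh i j \<epsilon> \<sigma>" using \<sigma>(1) by (simp add: dual_face_def)
    then obtain p where p: "is_face i p" "\<sigma> = face i p" "\<epsilon> \<subseteq> dual_cell mesh i (face i p)"
      by (elim boundary_face_cases) blast
    have yp: "y \<in> dual_cell mesh i (face i p)" using p(3) y_eps by blast
    have "p j \<le> m j" "m j \<le> p j + 1"
      using dual_cell_tick[OF p(1) yp, of j] ij by (auto simp: y_def tick_def)
    then have "m j - p j = 0 \<or> m j - p j = 1" by linarith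
    moreover have "p = m(j := m j - (m j - p j))" using index_off[OF p(1) yp] by auto
    ultimately have "m j - p j = r" using row_r p(1) yp by metis
    then have "p = q" using index_off[OF p(1) yp] by (auto simp: q_def)
    then show "\<sigma> = face i q" using p(2) by simp
  qed
  have mem_C: "x \<in> face_cell dom mesh i j \<epsilon> \<longleftrightarrow> (\<exists>y\<in>\<epsilon>. (\<forall>k. k \<noteq> j \<longrightarrow> x $ k = y $ k) \<and>
      x $ j \<in> closed_segment (mid j (m j - r)) (g j (m j)))" for x
    unfolding \<sigma>(2) \<sigma>_eq side_cell_def far using ij by (simp add: centre_face ctick_def q_def)
  have P1: "pt (w s) z \<in> face_cell dom mesh i j \<epsilon>"
    unfolding mem_C
  proof (intro bexI[OF _ y_eps] conjI allI impI)
    show "pt (w s) z $ j \<in> closed_segment (mid j (m j - r)) (g j (m j))" using z_seg by simp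
    fix k assume "k \<noteq> j"
    then show "pt (w s) z $ k = y $ k" by (cases "k = i") (auto simp: y_def)
  qed
  \<comment> \<open>On the other side both rows are present, so the corresponding point on the
    hyperplane orthogonal to \<open>e_j\<close> is interior and cannot belong to
    \<open>\<epsilon>\<close>.\<close>
  have P2: "pt (w (1 - s)) z \<notin> face_cell dom mesh i j \<epsilon>"
  proof
    assume "pt (w (1 - s)) z \<in> face_cell dom mesh i j \<epsilon>"
    then obtain y' where y': "y' \<in> \<epsilon>" "\<And>k. k \<noteq> j \<Longrightarrow> pt (w (1 - s)) z $ k = y' $ k"
      unfolding mem_C by blast
    have "y' \<in> dom"
    proof (rule two_cells_dom[of "corner i j m (1 - s) 0" j])
      have *: "corner i j m (1 - s) b \<in> A" if "b = 0 \<or> b = 1" for b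
        using that r s row other by auto
      show "corner i j m (1 - s) 0 \<in> A" using * by blast
      show "prev j (corner i j m (1 - s) 0) \<in> A" using *[of 1] by (simp add: corner_def)
      show "y' $ j = g j (corner i j m (1 - s) 0 j)"
        using y'(1) eps_sub(1) by (auto simp: F_def corner_def)
      fix k assume "k \<noteq> j"
      then show "g k (corner i j m (1 - s) 0 k) < y' $ k" "y' $ k < g k (corner i j m (1 - s) 0 k + 1)"
        using y'(2)[of k] w_grid[OF s'] mid_between[of k "m k"]
        by (cases "k = i"; auto simp: corner_def)+
    qed
    then show False using y'(1) eps_sub(2) mem_frontier by blast
  qed

  obtain \<epsilon>' where \<epsilon>': "\<epsilon>' \<in> dual_faces dom mesh j i" "face_cell dom mesh i j \<epsilon> = face_cell dom mesh j i \<epsilon>'"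
    using coincide eps_mem unfolding dual_partitions_coincide_def by blast
  obtain \<tau> N' where \<tau>: "dual_face dom mesh j i \<epsilon>' \<tau> N'" "face_cell dom mesh j i \<epsilon>' = side_cell i \<epsilon>' \<tau> N'"
    using dual_face_sides[OF \<epsilon>'(1)] by metis
  obtain y1 where y1: "y1 \<in> \<epsilon>'" "\<And>k. k \<noteq> i \<Longrightarrow> pt (w s) z $ k = y1 $ k"
     "w s \<in> closed_segment (centre \<tau> $ i) (far_point \<epsilon>' \<tau> N' $ i)"
    using P1 unfolding \<epsilon>'(2) \<tau>(2) side_cell_def by auto
  show False
  proof (cases N')
    case None
    then have "boundary_face dom mesh j i \<epsilon>' \<tau>" using \<tau>(1) by (simp add: dual_face_def)
    then obtain p t where p: "is_face j p" "\<tau> = face j p" "t \<in> {dlo j p i, dhi j p i}"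
      "\<epsilon>' \<subseteq> dual_cell mesh j (face j p) \<inter> {x. x $ i = t}" "\<epsilon>' \<subseteq> frontier dom"
      "far_point \<epsilon>' \<tau> None $ i = t" by (rule boundary_face_cases)
    have t: "t = g i (p i) \<or> t = g i (p i + 1)" using p(3) ij by (auto simp: dlo_def dhi_def tick_def)
    have seg: "w s \<in> closed_segment (mid i (p i)) t"
      using y1(3) p(2,6) ij None by (simp add: centre_face ctick_def)
    then have "g i (p i) \<le> w s" "w s \<le> g i (p i + 1)"
      using t mid_between[of i "p i"] by (auto simp: closed_segment_eq_real_ivl split: if_splits)
    then have "p i = m i - s"
      using strict_mono_gap_unique[OF grid_mono w_grid[OF s]] by blast
    \<comment> \<open>\<open>w s\<close> lies between the centre of its cell and the vertex, so the
      segment from that centre must end on the vertex side.\<close>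
    then have "t = g i (m i)"
      using seg t s w_mid[OF s] mid_between[of i "m i"] mid_between[of i "m i - 1"]
      by (auto simp: closed_segment_eq_real_ivl split: if_splits)
    have "y1 \<in> dom"
    proof (rule two_cells_dom[of "corner i j m 0 r" i])
      show "corner i j m 0 r \<in> A" by (rule row(1))
      show "prev i (corner i j m 0 r) \<in> A" using row(2) ij by (simp add: corner_def fun_upd_twist)
      show "y1 $ i = g i (corner i j m 0 r i)"
        using y1(1) p(4) \<open>t = g i (m i)\<close> ij by (auto simp: corner_def)
      fix k assume "k \<noteq> i"
      then show "g k (corner i j m 0 r k) < y1 $ k" "y1 $ k < g k (corner i j m 0 r k + 1)"
        using y1(2)[of k] z_grid mid_between[of k "m k"]
        by (cases "k = j"; auto simp: corner_def)+
    qed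
    then show False using y1(1) p(5) mem_frontier by blast
  next
    case (Some \<tau>')
    then have "common_face mesh j i \<epsilon>' \<tau> \<tau>'" using \<tau>(1) by (simp add: dual_face_def)
    then obtain p where p: "(\<tau> = face j p \<and> \<tau>' = face j (prev i p)) \<or> (\<tau>' = face j p \<and> \<tau> = face j (prev i p))"
      by (rule common_face_cases)
    \<comment> \<open>The segment joins consecutive centres, hence contains \<open>w (1 - s)\<close>
      as soon as it contains \<open>w s\<close>.\<close>
    have seg: "closed_segment (centre \<tau> $ i) (far_point \<epsilon>' \<tau> N' $ i) = {mid i (p i - 1)..mid i (p i)}"
      using p Some ij mid_between[of i "p i"] mid_between[of i "p i - 1"]
      by (auto simp: far_point_def centre_face ctick_def closed_segment_eq_real_ivl)
    then have "p i - 1 = m i - 1"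
      using strict_mono_gap_unique[OF mid_mono, of i "m i - 1" "w s" "p i - 1"] w_mid[OF s] y1(3) by simp
    then have "w (1 - s) \<in> closed_segment (centre \<tau> $ i) (far_point \<epsilon>' \<tau> N' $ i)"
      using w_mid[OF s'] unfolding seg by simp
    moreover have "pt (w (1 - s)) z $ k = y1 $ k" if "k \<noteq> i" for k
      using y1(2)[OF that] that by (cases "k = j") auto
    ultimately have "pt (w (1 - s)) z \<in> face_cell dom mesh j i \<epsilon>'"
      unfolding \<tau>(2) side_cell_def using y1(1) by auto
    then show False using P2 \<epsilon>'(2) by simp
  qed
qed

text \<open>If all alternatives fail, some row \<open>r\<close> and some column \<open>a\<close> of
  the four cells are present. They leave only the cell opposite to their common corner, which
  \<open>no_reentrant_corner\<close> supplies.\<close>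

lemma full_or_zero:
  assumes "dual_partitions_coincide dom mesh" "i \<noteq> j"
  shows "full i j m \<or> (inner_coef u i m = 0 \<and> inner_coef u i (prev j m) = 0) \<or>
    (inner_coef u j m = 0 \<and> inner_coef u j (prev i m) = 0)"
proof (rule ccontr)
  assume neg: "\<not> ?thesis"
  have c: "corner i j m 0 0 = m" "corner i j m 1 0 = prev i m" "corner i j m 0 1 = prev j m"
    "corner i j m 1 1 = prev i (prev j m)" "corner i j m 1 1 = prev j (prev i m)"
    using assms(2) by (auto simp: corner_def fun_upd_twist)
  have "(m \<in> A \<and> prev i m \<in> A) \<or> (prev j m \<in> A \<and> prev i (prev j m) \<in> A)"
    using neg by (auto simp: inner_coef_def split: if_splits)
  then obtain r :: int where r: "r = 0 \<or> r = 1" "corner i j m 0 r \<in> A" "corner i j m 1 r \<in> A"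
    using c by metis
  have "(m \<in> A \<and> prev j m \<in> A) \<or> (prev i m \<in> A \<and> prev j (prev i m) \<in> A)"
    using neg by (auto simp: inner_coef_def split: if_splits)
  then obtain a :: int where a: "a = 0 \<or> a = 1" "corner i j m a 0 \<in> A" "corner i j m a 1 \<in> A"
    using c by metis
  have "corner i j m (1 - a) (1 - r) \<in> A"
    using no_reentrant_corner[OF assms r(1), of "1 - a" m] r a by auto
  then have "corner i j m a b \<in> A" if "a = 0 \<or> a = 1" "b = 0 \<or> b = 1" for a b
    using r a that by auto
  then have "full i j m" using assms(2) c unfolding full_def by metis
  then show False using neg by blast
qed

end

section \<open>Integrals of products of derivatives\<close>

lemma measure_lebesgue_box_cart:
  fixes a b :: "real ^ 'n"
  assumes "\<And>k. a $ k \<le> b $ k"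
  shows "measure lebesgue (box a b) = (\<Prod>k\<in>UNIV. b $ k - a $ k)"
proof -
  have "measure lebesgue (box a b) = measure lborel (cbox a b)"
    by (simp add: measure_lborel_box_eq measure_lborel_cbox_eq)
  also have "\<dots> = (\<Prod>k\<in>UNIV. b $ k - a $ k)"
    using assms by (intro content_cbox_cart) (simp add: interval_ne_empty_cart)
  finally show ?thesis .
qed

lemma AE_coordinate_neq: "AE x in lebesgue. (x :: real ^ 'n) $ k \<noteq> c"
proof -
  have "negligible {x :: real ^ 'n. axis k 1 \<bullet> x = c}"
    by (rule negligible_hyperplane) (simp add: axis_eq_0_iff)
  then show ?thesis
    using AE_not_in[of "{x :: real ^ 'n. x $ k = c}" lebesgue]
    by (simp add: negligible_iff_null_sets inner_axis')
qed

lemma discrete_deriv_measurable [measurable]: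
  "discrete_deriv \<Omega> M i j u \<in> borel_measurable lebesgue"
proof -
  have "interior S \<in> sets lebesgue" for S :: "(real ^ 'n) set" by simp
  then show ?thesis unfolding discrete_deriv_def[abs_def] by measurable
qed

lemma discrete_deriv_bounded: "\<exists>B. \<forall>x. \<bar>discrete_deriv \<Omega> M i j u x\<bar> \<le> B"
proof (intro exI allI)
  fix x
  show "\<bar>discrete_deriv \<Omega> M i j u x\<bar> \<le> (\<Sum>\<epsilon>\<in>dual_faces \<Omega> M i j. \<bar>deriv_coef \<Omega> M i j u \<epsilon>\<bar>)"
    unfolding discrete_deriv_def
    by (rule order_trans[OF sum_abs sum_mono]) (simp add: indicator_def abs_mult)
qed

lemma discrete_deriv_prod_integrable:
  assumes "\<Omega> \<in> lmeasurable"
  shows "set_integrable lebesgue \<Omega> (\<lambda>x. discrete_deriv \<Omega> M i j u x * discrete_deriv \<Omega> M k l u x)"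
proof -
  obtain B C where B: "\<And>x. \<bar>discrete_deriv \<Omega> M i j u x\<bar> \<le> B" and C: "\<And>x. \<bar>discrete_deriv \<Omega> M k l u x\<bar> \<le> C"
    using discrete_deriv_bounded by metis
  have "0 \<le> B" using B[of undefined] by linarith
  then have "\<bar>discrete_deriv \<Omega> M i j u x * discrete_deriv \<Omega> M k l u x\<bar> \<le> B * C" for x
    using B C by (simp add: abs_mult mult_mono)
  moreover have "emeasure lebesgue \<Omega> < \<infinity>" "\<Omega> \<in> sets lebesgue"
    using assms unfolding fmeasurable_def by blast+
  ultimately show ?thesis
    unfolding set_integrable_def
    by (intro integrableI_bounded_set_indicator[where B = "B * C"]) auto
qed

context mac_grid
begin

section \<open>Decomposition of integrals over vertex boxes\<close>

lemma mid_cover: "\<exists>n. mid k n \<le> t \<and> t < mid k (n + 1)"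
proof -
  obtain n where n: "g k n \<le> t" "t < g k (n + 1)" using grid_cover by blast
  show ?thesis
  proof (cases "t < mid k n")
    case True
    then show ?thesis using n mid_between[of k "n - 1"] by (intro exI[of _ "n - 1"]) auto
  next
    case False
    then show ?thesis using n mid_between[of k "n + 1"] by (intro exI[of _ n]) auto
  qed
qed

lemma AE_vbox: "AE x in lebesgue. \<exists>m. x \<in> vbox i j m"
proof -
  have "AE x in lebesgue. \<forall>k n. x $ k \<noteq> g k n \<and> x $ k \<noteq> mid k n"
    by (simp add: AE_all_countable AE_conj_iff AE_coordinate_neq)
  then show ?thesis
  proof eventually_elim
    case (elim x)
    have "\<exists>n. tick i k n < x $ k \<and> x $ k < tick i k (n + 1)" for k
    proof (cases "k = i")
      case True
      obtain n where "mid k n \<le> x $ k" "x $ k < mid k (n + 1)" using mid_cover by blast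
      moreover have "mid k n \<noteq> x $ k" using elim by metis
      \<comment> \<open>\<open>tick i i n\<close> is \<open>mid i (n - 1)\<close>, hence the shift
        by one.\<close>
      ultimately show ?thesis using True by (intro exI[of _ "n + 1"]) (simp add: tick_def add.commute)
    next
      case False
      obtain n where "g k n \<le> x $ k" "x $ k < g k (n + 1)" using grid_cover by blast
      moreover have "g k n \<noteq> x $ k" using elim by metis
      ultimately show ?thesis using False by (intro exI[of _ n]) (simp add: tick_def)
    qed
    then obtain p where p: "\<And>k. tick i k (p k) < x $ k \<and> x $ k < tick i k (p k + 1)" by metis
    have "\<exists>n. ctick i j (n - 1) < x $ j \<and> x $ j < ctick i j n"
    proof (cases "j = i")
      case True
      obtain n where "g j n \<le> x $ j" "x $ j < g j (n + 1)" using grid_cover by blast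
      moreover have "g j n \<noteq> x $ j" using elim by metis
      ultimately show ?thesis using True by (intro exI[of _ "n + 1"]) (simp add: ctick_def)
    next
      case False
      obtain n where "mid j n \<le> x $ j" "x $ j < mid j (n + 1)" using mid_cover by blast
      moreover have "mid j n \<noteq> x $ j" using elim by metis
      ultimately show ?thesis using False by (intro exI[of _ "n + 1"]) (simp add: ctick_def)
    qed
    then obtain n where "ctick i j (n - 1) < x $ j \<and> x $ j < ctick i j n" by blast
    then have "x \<in> vbox i j (p(j := n))" using p by (auto simp: mem_vbox)
    then show ?case by blast
  qed
qed

lemma vbox_disjoint:
  assumes "x \<in> vbox i j m" "x \<in> vbox i j p"
  shows "p = m"
proof
  fix k
  show "p k = m k"
  proof (cases "k = j")
    case True
    then show ?thesis
      using strict_mono_gap_unique[OF ctick_mono, of i j "m j - 1" "x $ j" "p j - 1"] assms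
      by (auto simp: mem_vbox)
  next
    case False
    then show ?thesis
      using strict_mono_gap_unique[OF tick_mono, of i k "m k" "x $ k" "p k"] assms
      by (auto simp: mem_vbox)
  qed
qed

definition side_length :: "'n \<Rightarrow> 'n \<Rightarrow> ('n \<Rightarrow> int) \<Rightarrow> 'n \<Rightarrow> real" where
  "side_length i j m k = (if k = j then ctick i j (m j) - ctick i j (m j - 1)
     else tick i k (m k + 1) - tick i k (m k))"

lemma measure_vbox: "measure lebesgue (vbox i j m) = (\<Prod>k\<in>UNIV. side_length i j m k)"
proof -
  have "ctick i j (m j - 1) < ctick i j (m j)" by simp
  then show ?thesis
    unfolding vbox_def
    by (subst measure_lebesgue_box_cart) (auto simp: side_length_def less_imp_le simp del: ctick_less intro!: prod.cong)
qed

text \<open>The boxes cover almost everything, and those with a nonzero value lie inside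
  \<open>dom\<close>, so none is cut by the boundary. \<open>Sum_any\<close> leaves the index range
  unbounded, ready for translations.\<close>

lemma integral_vbox_constant:
  assumes F [measurable]: "F \<in> borel_measurable lebesgue"
    and c: "\<And>m x. x \<in> vbox i j m \<Longrightarrow> F x = c m"
    and fin: "finite {m. c m \<noteq> 0}" and sub: "\<And>m. c m \<noteq> 0 \<Longrightarrow> vbox i j m \<subseteq> dom"
  shows "(LINT x:dom|lebesgue. F x) = Sum_any (\<lambda>m. c m * (\<Prod>k\<in>UNIV. side_length i j m k))"
proof -
  let ?T = "{m. c m \<noteq> 0}"
  have meas: "vbox i j m \<in> sets lebesgue" "emeasure lebesgue (vbox i j m) < \<infinity>" for m
    using lmeasurable_box unfolding vbox_def fmeasurable_def by blast+
  have dom: "dom \<in> sets lebesgue" using open_dom by simp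
  have "(LINT x:dom|lebesgue. F x) = (LINT x|lebesgue. (\<Sum>m\<in>?T. c m * indicator (vbox i j m) x))"
    unfolding set_lebesgue_integral_def
  proof (rule integral_cong_AE)
    show "(\<lambda>x. indicat_real dom x *\<^sub>R F x) \<in> borel_measurable lebesgue"
      using dom by measurable
    show "(\<lambda>x. \<Sum>m\<in>?T. c m * indicat_real (vbox i j m) x) \<in> borel_measurable lebesgue"
      using meas(1) by measurable
    show "AE x in lebesgue. indicat_real dom x *\<^sub>R F x = (\<Sum>m\<in>?T. c m * indicat_real (vbox i j m) x)"
      using AE_vbox[of i j]
    proof eventually_elim
      case (elim x)
      then obtain m where m: "x \<in> vbox i j m" by blast
      have other: "indicat_real (vbox i j p) x = 0" if "p \<noteq> m" for p
        using vbox_disjoint[OF m, of p] that by (auto simp: indicator_def)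
      show ?case
      proof (cases "c m = 0")
        case True
        then have "(\<Sum>p\<in>?T. c p * indicat_real (vbox i j p) x) = 0"
          using other by (intro sum.neutral) (metis (mono_tags) mem_Collect_eq mult_zero_right)
        then show ?thesis using c[OF m] True by simp
      next
        case False
        then have "(\<Sum>p\<in>?T. c p * indicat_real (vbox i j p) x) = c m * indicat_real (vbox i j m) x"
          using other fin by (subst sum.remove[of _ m]) (auto intro!: sum.neutral)
        then show ?thesis using c[OF m] sub[OF False] m by (auto simp: indicator_def)
      qed
    qed
  qed
  also have "\<dots> = (\<Sum>m\<in>?T. c m * measure lebesgue (vbox i j m))"
    using meas by (subst Bochner_Integration.integral_sum) (auto simp: integrable_indicator_iff)
  also have "\<dots> = Sum_any (\<lambda>m. c m * (\<Prod>k\<in>UNIV. side_length i j m k))"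
    unfolding measure_vbox using fin by (intro Sum_any.expand_superset[symmetric]) auto
  finally show ?thesis .
qed

text \<open>The length of the grid edge at \<open>m\<close> if \<open>d = 3\<close>, and the empty
  product 1 if \<open>d = 2\<close>.\<close>

definition weight :: "'n \<Rightarrow> 'n \<Rightarrow> ('n \<Rightarrow> int) \<Rightarrow> real" where
  "weight i j m = (\<Prod>k\<in>UNIV - {i, j}. g k (m k + 1) - g k (m k))"

lemma weight_upd [simp]: "weight i j (m(i := a)) = weight i j m" "weight i j (m(j := a)) = weight i j m"
  by (auto simp: weight_def intro!: prod.cong)

lemma finite_inner_coef: "finite {m. inner_coef u i m \<noteq> 0}"
  by (rule finite_subset[OF _ finite_cells]) (auto simp: inner_coef_def split: if_splits)

lemma bij_upd_shift: "bij (\<lambda>m :: 'n \<Rightarrow> int. m(j := m j + a))"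
  by (rule bij_betwI[where g = "\<lambda>m. m(j := m j - a)"]) auto

lemma finite_shift:
  assumes "finite {m :: 'n \<Rightarrow> int. P m}"
  shows "finite {m. P (m(j := m j + a))}"
  using finite_vimageI[OF assms bij_is_inj[OF bij_upd_shift], of j a] by (simp add: vimage_def)

text \<open>Multiplied out, both sides share the term \<open>b\<close>; the other terms match after
  translations in directions \<open>i\<close> and \<open>j\<close>, which preserve
  \<open>weight\<close>. Each term has a factor \<open>f\<close>, so all sums have finite support.
  The right side is written at the cell \<open>prev i m\<close>.\<close>

lemma summation_by_parts:
  fixes f h :: "('n \<Rightarrow> int) \<Rightarrow> real"
  assumes ij: "i \<noteq> j" and f: "finite {m. f m \<noteq> 0}"
  shows "Sum_any (\<lambda>m. (f m - f (prev j m)) * (h m - h (prev i m)) * weight i j m) =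
     Sum_any (\<lambda>m. (f m - f (prev i m)) * (h ((prev i m)(j := m j + 1)) - h (prev i m)) * weight i j m)"
    (is "?L = ?R")
proof -
  define a where "a m = f m * h m * weight i j m" for m
  define b where "b m = - f m * h (prev i m) * weight i j m" for m
  define c where "c m = - f (prev j m) * h m * weight i j m" for m
  define d where "d m = f (prev j m) * h (prev i m) * weight i j m" for m
  define a' where "a' m = f (prev i m) * h (prev i m) * weight i j m" for m
  define c' where "c' m = - f (prev i m) * h ((prev i m)(j := m j + 1)) * weight i j m" for m
  define d' where "d' m = f m * h ((prev i m)(j := m j + 1)) * weight i j m" for m
  note defs = a_def b_def c_def d_def a'_def c'_def d'_def
  have fp: "finite {m. f (prev k m) \<noteq> 0}" for k
    using finite_shift[OF f, of k "-1"] by simp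
  have fin: "finite {m. a m \<noteq> 0}" "finite {m. b m \<noteq> 0}" "finite {m. c m \<noteq> 0}" "finite {m. d m \<noteq> 0}"
    "finite {m. a' m \<noteq> 0}" "finite {m. c' m \<noteq> 0}" "finite {m. d' m \<noteq> 0}"
    using f fp[of i] fp[of j] unfolding defs by (auto elim!: rev_finite_subset)
  have sum4: "Sum_any (\<lambda>m. p m + q m + r m + s m) = Sum_any p + Sum_any q + Sum_any r + Sum_any s"
    if "finite {m. p m \<noteq> 0}" "finite {m. q m \<noteq> 0}" "finite {m. r m \<noteq> 0}" "finite {m. s m \<noteq> 0}"
    for p q r s :: "('n \<Rightarrow> int) \<Rightarrow> real"
  proof -
    have "finite {m. p m + q m \<noteq> 0}" "finite {m. p m + q m + r m \<noteq> 0}"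
      using that(1-3) by (auto intro: finite_subset[of _ "{m. p m \<noteq> 0} \<union> {m. q m \<noteq> 0} \<union> {m. r m \<noteq> 0}"])
    then show ?thesis using that by (simp add: Sum_any.distrib)
  qed
  have "?L = Sum_any (\<lambda>m. a m + b m + c m + d m)"
    by (rule Sum_any.cong) (simp add: defs algebra_simps)
  also have "\<dots> = Sum_any a + Sum_any b + Sum_any c + Sum_any d" by (intro sum4 fin)
  also have "Sum_any a = Sum_any a'"
    by (rule Sum_any.reindex_cong[OF bij_upd_shift[of i "-1"]]) (simp add: defs comp_def fun_eq_iff)
  also have "Sum_any d = Sum_any d'"
    by (rule Sum_any.reindex_cong[OF bij_upd_shift[of j 1]])
      (use ij in \<open>simp add: defs comp_def fun_eq_iff fun_upd_twist\<close>)
  also have "Sum_any c = Sum_any c'"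
    by (rule Sum_any.reindex_cong[OF bij_comp[OF bij_upd_shift[of i "-1"] bij_upd_shift[of j 1]]])
      (use ij in \<open>simp add: defs comp_def fun_eq_iff fun_upd_twist\<close>)
  also have "Sum_any a' + Sum_any b + Sum_any c' + Sum_any d' = Sum_any (\<lambda>m. a' m + b m + c' m + d' m)"
    by (intro sum4[symmetric] fin)
  also have "\<dots> = ?R"
    by (rule Sum_any.cong) (simp add: defs algebra_simps)
  finally show ?thesis .
qed

lemma finite_inner_coef_increments: "finite {m. inner_coef u i m - inner_coef u i (prev j m) \<noteq> 0}"
proof (rule finite_subset)
  show "{m. inner_coef u i m - inner_coef u i (prev j m) \<noteq> 0} \<subseteq>
      {m. inner_coef u i m \<noteq> 0} \<union> {m. inner_coef u i (prev j m) \<noteq> 0}" by auto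
  show "finite ({m. inner_coef u i m \<noteq> 0} \<union> {m. inner_coef u i (prev j m) \<noteq> 0})"
    using finite_inner_coef finite_shift[OF finite_inner_coef, of u i j "-1"] by simp
qed

lemma integral_mixed:
  assumes u: "u \<in> mac_space dom mesh" and coincide: "dual_partitions_coincide dom mesh" and ij: "i \<noteq> j"
  shows "(LINT x:dom|lebesgue. discrete_deriv dom mesh i j u x * discrete_deriv dom mesh j i u x) =
    Sum_any (\<lambda>m. (inner_coef u i m - inner_coef u i (prev j m)) *
      (inner_coef u j m - inner_coef u j (prev i m)) * weight i j m)"
proof -
  define \<delta> where "\<delta> k m = mid k (m k) - mid k (m k - 1)" for k and m :: "'n \<Rightarrow> int"
  have \<delta>: "\<delta> k m > 0" for k m
    using mid_mono[of k] by (simp add: \<delta>_def strict_mono_def)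
  define c where "c m = (inner_coef u i m - inner_coef u i (prev j m)) / \<delta> j m *
     ((inner_coef u j m - inner_coef u j (prev i m)) / \<delta> i m)" for m
  \<comment> \<open>For \<open>i \<noteq> j\<close> both boxes run between cell centres in
    directions \<open>i\<close> and \<open>j\<close>, so the two derivatives can be compared box by
    box.\<close>
  have swap: "vbox i j m = vbox j i m" "full i j m = full j i m" for m
    using ij by (auto simp: mem_vbox set_eq_iff tick_def ctick_def full_def fun_upd_twist)
  have \<delta>_ctick: "ctick i j (m j) - ctick i j (m j - 1) = \<delta> j m" "ctick j i (m i) - ctick j i (m i - 1) = \<delta> i m" for m
    using ij by (simp_all add: ctick_def \<delta>_def)
  have "(LINT x:dom|lebesgue. discrete_deriv dom mesh i j u x * discrete_deriv dom mesh j i u x) =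
     Sum_any (\<lambda>m. c m * (\<Prod>k\<in>UNIV. side_length i j m k))"
  proof (rule integral_vbox_constant)
    show "(\<lambda>x. discrete_deriv dom mesh i j u x * discrete_deriv dom mesh j i u x) \<in> borel_measurable lebesgue"
      by measurable
    show "finite {m. c m \<noteq> 0}"
      by (rule finite_subset[OF _ finite_inner_coef_increments[of u i j]]) (auto simp: c_def)
    show "vbox i j m \<subseteq> dom" if "c m \<noteq> 0" for m
      using full_or_zero[OF coincide ij, of m u] that full_vbox_subset[of i j m] by (auto simp: c_def)
    fix m x assume x: "x \<in> vbox i j m"
    consider "full i j m" | "inner_coef u i m = 0" "inner_coef u i (prev j m) = 0"
      | "inner_coef u j m = 0" "inner_coef u j (prev i m) = 0"
      using full_or_zero[OF coincide ij, of m u] by blast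
    then show "discrete_deriv dom mesh i j u x * discrete_deriv dom mesh j i u x = c m"
    proof cases
      case 1
      then show ?thesis
        using discrete_deriv_full[OF u, of i j m x] discrete_deriv_full[OF u, of j i m x] x
        by (simp add: swap \<delta>_ctick c_def)
    next
      case 2
      then show ?thesis using discrete_deriv_zero[OF u x] by (simp add: c_def)
    next
      case 3
      then show ?thesis using discrete_deriv_zero[OF u, of x j i m] x by (simp add: c_def swap)
    qed
  qed
  also have "\<dots> = Sum_any (\<lambda>m. (inner_coef u i m - inner_coef u i (prev j m)) *
      (inner_coef u j m - inner_coef u j (prev i m)) * weight i j m)"
  proof (rule Sum_any.cong)
    fix m
    have "(\<Prod>k\<in>UNIV. side_length i j m k) = side_length i j m i * (side_length i j m j * weight i j m)"
      using ij by (subst prod.remove[of _ i]; simp?) (subst prod.remove[of _ j];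
        auto simp: weight_def side_length_def tick_def intro!: prod.cong)
    also have "side_length i j m i = \<delta> i m" using ij by (simp add: side_length_def tick_def \<delta>_def)
    also have "side_length i j m j = \<delta> j m" using ij by (simp add: side_length_def ctick_def \<delta>_def)
    finally show "c m * (\<Prod>k\<in>UNIV. side_length i j m k) = (inner_coef u i m - inner_coef u i (prev j m)) *
      (inner_coef u j m - inner_coef u j (prev i m)) * weight i j m"
      using \<delta>[of i m] \<delta>[of j m] by (simp add: c_def)
  qed
  finally show ?thesis .
qed

text \<open>The box is the interior of the cell \<open>prev i m\<close>. If that cell is absent, its
  two faces orthogonal to \<open>e_i\<close> have zero \<open>inner_coef\<close>, and the quotient
  formula still holds.\<close>

lemma discrete_deriv_diagonal:
  assumes "u \<in> mac_space dom mesh" "x \<in> vbox i i m"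
  shows "discrete_deriv dom mesh i i u x =
    (inner_coef u i m - inner_coef u i (prev i m)) / (g i (m i) - g i (m i - 1))"
proof (cases "full i i m")
  case True
  then show ?thesis using discrete_deriv_full[OF assms(1) True assms(2)] by (simp add: ctick_def)
next
  case False
  then have "inner_coef u i m = 0" "inner_coef u i (prev i m) = 0"
    by (simp_all add: full_def inner_coef_def)
  then show ?thesis using discrete_deriv_zero[OF assms] by simp
qed

lemma integral_diagonal:
  assumes u: "u \<in> mac_space dom mesh" and ij: "i \<noteq> j"
  shows "(LINT x:dom|lebesgue. discrete_deriv dom mesh i i u x * discrete_deriv dom mesh j j u x) =
    Sum_any (\<lambda>m. (inner_coef u i m - inner_coef u i (prev i m)) *
      (inner_coef u j ((prev i m)(j := m j + 1)) - inner_coef u j (prev i m)) * weight i j m)"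
proof -
  define h where "h k n = g k (n + 1) - g k n" for k n
  have h: "h k n > 0" for k n by (simp add: h_def)
  define c where "c m = (inner_coef u i m - inner_coef u i (prev i m)) / h i (m i - 1) *
     ((inner_coef u j ((prev i m)(j := m j + 1)) - inner_coef u j (prev i m)) / h j (m j))" for m
  have "(LINT x:dom|lebesgue. discrete_deriv dom mesh i i u x * discrete_deriv dom mesh j j u x) =
     Sum_any (\<lambda>m. c m * (\<Prod>k\<in>UNIV. side_length i i m k))"
  proof (rule integral_vbox_constant)
    show "(\<lambda>x. discrete_deriv dom mesh i i u x * discrete_deriv dom mesh j j u x) \<in> borel_measurable lebesgue"
      by measurable
    show "finite {m. c m \<noteq> 0}"
      by (rule finite_subset[OF _ finite_inner_coef_increments[of u i i]]) (auto simp: c_def)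
    show "vbox i i m \<subseteq> dom" if "c m \<noteq> 0" for m
    proof (rule full_vbox_subset)
      show "full i i m" using that by (auto simp: c_def full_def inner_coef_def split: if_splits)
    qed
    fix m x assume x: "x \<in> vbox i i m"
    \<comment> \<open>The index for which the \<open>(j,j)\<close> box is the same primal cell:
      \<open>prev j ?p = prev i m\<close>.\<close>
    let ?p = "(prev i m)(j := m j + 1)"
    have "x \<in> vbox j j ?p"
      unfolding mem_vbox
    proof (intro conjI allI impI)
      fix k assume "k \<noteq> j"
      then show "tick j k (?p k) < x $ k" "x $ k < tick j k (?p k + 1)"
        using x ij by (cases "k = i"; auto simp: mem_vbox tick_def ctick_def)+
    qed (use x ij in \<open>auto simp: mem_vbox tick_def ctick_def\<close>)
    moreover have "prev j ?p = prev i m" using ij by (auto simp: fun_eq_iff)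
    ultimately show "discrete_deriv dom mesh i i u x * discrete_deriv dom mesh j j u x = c m"
      using discrete_deriv_diagonal[OF u x] discrete_deriv_diagonal[OF u, of x j ?p]
      by (simp add: c_def h_def)
  qed
  also have "\<dots> = Sum_any (\<lambda>m. (inner_coef u i m - inner_coef u i (prev i m)) *
      (inner_coef u j ((prev i m)(j := m j + 1)) - inner_coef u j (prev i m)) * weight i j m)"
  proof (rule Sum_any.cong)
    fix m
    have "(\<Prod>k\<in>UNIV. side_length i i m k) = side_length i i m i * (side_length i i m j * weight i j m)"
      using ij by (subst prod.remove[of _ i]; simp?) (subst prod.remove[of _ j];
        auto simp: weight_def side_length_def tick_def intro!: prod.cong)
    also have "side_length i i m i = h i (m i - 1)" by (simp add: side_length_def ctick_def h_def)
    also have "side_length i i m j = h j (m j)" using ij by (simp add: side_length_def tick_def h_def)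
    finally show "c m * (\<Prod>k\<in>UNIV. side_length i i m k) = (inner_coef u i m - inner_coef u i (prev i m)) *
      (inner_coef u j ((prev i m)(j := m j + 1)) - inner_coef u j (prev i m)) * weight i j m"
      using h[of i "m i - 1"] h[of j "m j"] by (simp add: c_def)
  qed
  finally show ?thesis .
qed

lemma integral_mixed_eq_diagonal:
  assumes "u \<in> mac_space dom mesh" "dual_partitions_coincide dom mesh"
  shows "(LINT x:dom|lebesgue. discrete_deriv dom mesh i j u x * discrete_deriv dom mesh j i u x) =
    (LINT x:dom|lebesgue. discrete_deriv dom mesh i i u x * discrete_deriv dom mesh j j u x)"
proof (cases "i = j")
  case False
  then show ?thesis
    using integral_mixed[OF assms False] integral_diagonal[OF assms(1) False]
      summation_by_parts[OF False finite_inner_coef] by simp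
qed simp

section \<open>The Korn inequality on an indexed grid\<close>

lemma dom_lmeasurable: "dom \<in> lmeasurable"
proof (rule lmeasurable_open[OF _ open_dom])
  have "bounded (\<Union>mesh)" using finite_cells by (auto simp: mesh_def cell_def)
  then show "bounded dom" unfolding dom_def by (rule bounded_subset[OF _ interior_subset])
qed

lemma discrete_korn:
  assumes "u \<in> mac_space dom mesh" "dual_partitions_coincide dom mesh"
  shows "norm_1E0 dom mesh u \<le> sqrt 2 * matrix_L2_norm_on dom (discrete_strain dom mesh u)"
proof -
  define a where "a i j = discrete_deriv dom mesh i j u" for i j
  define I where "I i j k l = (LINT x:dom|lebesgue. a i j x * a k l x)" for i j k l
  have int: "set_integrable lebesgue dom (\<lambda>x. a i j x * a k l x)" for i j k l
    unfolding a_def by (rule discrete_deriv_prod_integrable[OF dom_lmeasurable])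
  have L2: "(L2_norm_on dom f)\<^sup>2 = (LINT x:dom|lebesgue. (f x)\<^sup>2)" for f
    unfolding L2_norm_on_def set_lebesgue_integral_def
    by (rule real_sqrt_pow2) (simp add: integral_nonneg_AE)
  have strain: "(LINT x:dom|lebesgue. ((a i j x + a j i x) / 2)\<^sup>2) = (I i j i j + I j i j i + 2 * I i j j i) / 4" for i j
  proof -
    have "(LINT x:dom|lebesgue. ((a i j x + a j i x) / 2)\<^sup>2) =
       (LINT x:dom|lebesgue. (a i j x * a i j x + a j i x * a j i x + 2 * (a i j x * a j i x)) / 4)"
      by (rule arg_cong[where f = "set_lebesgue_integral lebesgue dom"]) (auto simp: fun_eq_iff power2_eq_square field_simps)
    also have "\<dots> = (I i j i j + I j i j i + 2 * I i j j i) / 4"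
      unfolding I_def using int by simp
    finally show ?thesis .
  qed
  have "(\<Sum>i\<in>UNIV. \<Sum>j\<in>UNIV. I i j j i) = (\<Sum>i\<in>UNIV. \<Sum>j\<in>UNIV. I i i j j)"
    unfolding I_def a_def using integral_mixed_eq_diagonal[OF assms] by simp
  also have "\<dots> = (LINT x:dom|lebesgue. (\<Sum>i\<in>UNIV. a i i x)\<^sup>2)"
  proof -
    have "(LINT x:dom|lebesgue. (\<Sum>i\<in>UNIV. a i i x)\<^sup>2) =
       (LINT x|lebesgue. (\<Sum>i\<in>UNIV. \<Sum>j\<in>UNIV. indicat_real dom x *\<^sub>R (a i i x * a j j x)))"
      unfolding set_lebesgue_integral_def power2_eq_square sum_product by (simp add: sum_distrib_left)
    also have "\<dots> = (\<Sum>i\<in>UNIV. LINT x|lebesgue. (\<Sum>j\<in>UNIV. indicat_real dom x *\<^sub>R (a i i x * a j j x)))"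
      using int[unfolded set_integrable_def]
      by (intro Bochner_Integration.integral_sum Bochner_Integration.integrable_sum)
    also have "\<dots> = (\<Sum>i\<in>UNIV. \<Sum>j\<in>UNIV. I i i j j)"
      unfolding I_def set_lebesgue_integral_def using int[unfolded set_integrable_def]
      by (intro sum.cong refl Bochner_Integration.integral_sum)
    finally show ?thesis by simp
  qed
  also have "\<dots> \<ge> 0" unfolding set_lebesgue_integral_def by (simp add: integral_nonneg_AE)
  finally have cross: "(\<Sum>i\<in>UNIV. \<Sum>j\<in>UNIV. I i j j i) \<ge> 0" .
  have "(\<Sum>i\<in>UNIV. \<Sum>j\<in>UNIV. (L2_norm_on dom (a i j))\<^sup>2) = (\<Sum>i\<in>UNIV. \<Sum>j\<in>UNIV. I i j i j)"
    unfolding L2 by (simp add: I_def power2_eq_square)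
  also have "\<dots> \<le> (\<Sum>i\<in>UNIV. \<Sum>j\<in>UNIV. I i j i j) + (\<Sum>i\<in>UNIV. \<Sum>j\<in>UNIV. I i j j i)"
    using cross by simp
  \<comment> \<open>Exchanging \<open>i\<close> and \<open>j\<close> makes the first two sums equal,
    so the pure and the mixed terms each get the factor 1/2 that the 2 in front removes.\<close>
  also have "\<dots> = 2 * (\<Sum>i\<in>UNIV. \<Sum>j\<in>UNIV. (I i j i j + I j i j i + 2 * I i j j i) / 4)"
    using sum.swap[of "\<lambda>i j. I j i j i" UNIV UNIV]
    by (simp add: sum.distrib flip: sum_divide_distrib sum_distrib_left)
  also have "\<dots> = 2 * (\<Sum>i\<in>UNIV. \<Sum>j\<in>UNIV. (L2_norm_on dom (\<lambda>x. discrete_strain dom mesh u x $ i $ j))\<^sup>2)"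
    unfolding L2 by (simp add: discrete_strain_def strain flip: a_def)
  finally show ?thesis
    unfolding norm_1E0_def matrix_L2_norm_on_def a_def by (simp flip: real_sqrt_mult)
qed

end

section \<open>Meshes as indexed grids\<close>

lemma strict_mono_cover:
  fixes f :: "int \<Rightarrow> real"
  assumes "f p \<le> t" "t < f q" "strict_mono f"
  shows "\<exists>n. f n \<le> t \<and> t < f (n + 1)"
proof -
  let ?S = "{n \<in> {p..q}. f n \<le> t}"
  have "f p < f q" using assms(1,2) by linarith
  then have "p < q" using strict_mono_less[OF assms(3)] by blast
  then have "p \<in> ?S" using assms(1) by simp
  then have S: "finite ?S" "?S \<noteq> {}" by (auto intro: finite_subset[of _ "{p..q}"])
  then have max: "Max ?S \<in> ?S" by (rule Max_in)
  then have "Max ?S \<noteq> q" using assms(2) by auto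
  then have "Max ?S + 1 \<in> {p..q}" using max by auto
  moreover have "Max ?S + 1 \<notin> ?S" using Max_ge[OF S(1), of "Max ?S + 1"] by auto
  ultimately have "t < f (Max ?S + 1)" by auto
  then show ?thesis using max by blast
qed

text \<open>The sorted list of \<open>G\<close> is continued by unit steps beyond both ends:
  \<open>c\<close> clamps an index to the list, and \<open>n - c n\<close> counts the steps taken
  outside.\<close>

lemma finite_set_enumeration:
  fixes G :: "real set"
  assumes "finite G"
  obtains f :: "int \<Rightarrow> real" where "strict_mono f" "\<And>t. \<exists>n. f n \<le> t \<and> t < f (n + 1)"
    "\<And>a b. a < b \<Longrightarrow> {a..b} \<inter> G = {a, b} \<Longrightarrow> \<exists>n. a = f n \<and> b = f (n + 1)"
proof (cases "G = {}")
  case True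
  have "strict_mono (of_int :: int \<Rightarrow> real)" by (simp add: strict_mono_def)
  moreover have "\<exists>n. of_int n \<le> t \<and> t < of_int (n + 1)" for t :: real
    using floor_correct[of t] by (intro exI[of _ "\<lfloor>t\<rfloor>"]) simp
  ultimately show thesis using that[of of_int] True by auto
next
  case False
  define xs where "xs = sorted_list_of_set G"
  define N where "N = int (length xs)"
  define c where "c n = max 0 (min n (N - 1))" for n
  define f where "f n = xs ! nat (c n) + of_int (n - c n)" for n
  have set_xs: "set xs = G" using assms by (simp add: xs_def)
  have "xs \<noteq> []" using False assms by (simp add: xs_def)
  then have N: "N \<ge> 1" by (cases xs) (auto simp: N_def)
  have nth_less: "xs ! a < xs ! b" if "a < b" "b < length xs" for a b
    using sorted_wrt_nth_less[OF strict_sorted_list_of_set[of G]] that by (simp add: xs_def)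
  have c_len: "nat (c n) < length xs" for n using N by (auto simp: c_def N_def)
  have f_less: "f n < f m" if "n < m" for n m
  proof (cases "c n = c m")
    case True
    then show ?thesis using that by (simp add: f_def)
  next
    case False
    then have "c n < c m" "n - c n \<le> m - c m" using that N by (auto simp: c_def)
    moreover have "c n \<ge> 0" by (simp add: c_def)
    ultimately have "xs ! nat (c n) < xs ! nat (c m)" "real_of_int (n - c n) \<le> of_int (m - c m)"
      using c_len[of m] by (auto intro!: nth_less simp: of_int_le_iff simp del: of_int_diff)
    then show ?thesis unfolding f_def by (rule add_less_le_mono)
  qed
  then have mono: "strict_mono f" by (rule strict_monoI)
  have cover: "\<exists>n. f n \<le> t \<and> t < f (n + 1)" for t
  proof -
    obtain p :: int where p: "p \<le> 0" "of_int p \<le> t - xs ! 0"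
      using floor_correct[of "min 0 (t - xs ! 0)"] by (intro that[of "\<lfloor>min 0 (t - xs ! 0)\<rfloor>"]) linarith+
    then have "f p \<le> t" using N by (simp add: f_def c_def)
    obtain q :: int where q: "N - 1 \<le> q" "t - xs ! nat (N - 1) < of_int (q - (N - 1))"
    proof (rule that[of "N + \<lfloor>max 0 (t - xs ! nat (N - 1))\<rfloor>"])
      have "0 \<le> \<lfloor>max 0 (t - xs ! nat (N - 1))\<rfloor>" by (simp only: zero_le_floor max.cobounded1)
      then show "N - 1 \<le> N + \<lfloor>max 0 (t - xs ! nat (N - 1))\<rfloor>" by linarith
      show "t - xs ! nat (N - 1) < of_int (N + \<lfloor>max 0 (t - xs ! nat (N - 1))\<rfloor> - (N - 1))"
        using floor_correct[of "max 0 (t - xs ! nat (N - 1))"] by linarith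
    qed
    then have "t < f q" using N by (simp add: f_def c_def)
    then show ?thesis using strict_mono_cover[OF \<open>f p \<le> t\<close> _ mono] by blast
  qed
  have "\<exists>n. a = f n \<and> b = f (n + 1)" if ab: "a < b" "{a..b} \<inter> G = {a, b}" for a b
  proof -
    obtain p q where pq: "p < length xs" "a = xs ! p" "q < length xs" "b = xs ! q"
      using ab(2) set_xs by (metis in_set_conv_nth insertCI IntD2)
    have "p < q"
      using ab(1) pq nth_less[of q p] by (metis linorder_neqE_nat order_less_asym order_less_irrefl)
    \<comment> \<open>Otherwise the next list entry would be a point of \<open>G\<close> strictly
      between \<open>a\<close> and \<open>b\<close>.\<close>
    have "q = p + 1"
    proof (rule ccontr)
      assume "q \<noteq> p + 1"
      then have "a < xs ! (p + 1)" "xs ! (p + 1) < b"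
        using \<open>p < q\<close> pq nth_less[of p "p + 1"] nth_less[of "p + 1" q] by auto
      moreover have "xs ! (p + 1) \<in> G" using \<open>p < q\<close> pq(3) set_xs by (metis Suc_eq_plus1 Suc_leI nth_mem order_le_less_trans)
      ultimately have "xs ! (p + 1) \<in> {a, b}" using ab(2) by (metis IntI atLeastAtMost_iff less_imp_le)
      then show False using \<open>a < xs ! (p + 1)\<close> \<open>xs ! (p + 1) < b\<close> by auto
    qed
    have "f (int r) = xs ! r" if "r < length xs" for r
    proof -
      have "c (int r) = int r" using that by (auto simp: c_def N_def)
      then show ?thesis by (simp add: f_def)
    qed
    then have "a = f (int p)" "b = f (int p + 1)"
      using pq \<open>q = p + 1\<close> by (metis of_nat_Suc Suc_eq_plus1 of_nat_1 of_nat_add)+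
    then show ?thesis by blast
  qed
  then show thesis using that mono cover by blast
qed

text \<open>A finite union of nondegenerate closed boxes is the closure of its interior, so the
  boxes defining the domain and the cells have the same union.\<close>

lemma mac_domain_eq_interior_mesh:
  assumes "mac_domain \<Omega>" "\<Union>M = closure \<Omega>"
  shows "\<Omega> = interior (\<Union>M)"
proof -
  obtain R where R: "finite R" "\<And>B. B \<in> R \<Longrightarrow> \<exists>a b. (\<forall>k. a $ k < b $ k) \<and> B = cbox a b"
    "\<Omega> = interior (\<Union>R)"
    using assms(1) unfolding mac_domain_def by blast
  have "\<Union>R \<subseteq> closure \<Omega>"
  proof (rule Union_least)
    fix B assume B: "B \<in> R"
    then obtain a b where ab: "\<And>k. a $ k < b $ k" "B = cbox a b" using R(2) by blast
    then have "closure (interior B) = B"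
      unfolding ab(2) interior_cbox by (intro closure_box) (simp add: interval_ne_empty_cart)
    moreover have "interior B \<subseteq> \<Omega>" unfolding R(3) using B by (intro interior_mono) blast
    ultimately show "B \<subseteq> closure \<Omega>" using closure_mono by blast
  qed
  moreover have "closed (\<Union>R)" using R(1) by (rule closed_Union) (use R(2) closed_cbox in metis)
  then have "closure \<Omega> \<subseteq> \<Union>R" unfolding R(3) by (intro closure_minimal interior_subset)
  ultimately show ?thesis using R(3) assms(2) by simp
qed

theorem lemma3p9:
  fixes \<Omega> :: "(real ^ 'n) set" and M :: "(real ^ 'n) set set" and u :: "real ^ 'n \<Rightarrow> real ^ 'n"
  assumes "CARD('n) = 2 \<or> CARD('n) = 3"
    and "mac_domain \<Omega>"
    and "mac_mesh \<Omega> M"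
    and "dual_partitions_coincide \<Omega> M"
    and "u \<in> mac_space \<Omega> M"
  shows "norm_1E0 \<Omega> M u \<le> sqrt 2 * matrix_L2_norm_on \<Omega> (discrete_strain \<Omega> M u)"
proof -
  obtain G :: "'n \<Rightarrow> real set" where G: "\<forall>k. finite (G k)" and
    cells: "\<forall>K\<in>M. \<exists>a b. K = cbox a b \<and>
       (\<forall>k. a $ k < b $ k \<and> {a $ k..b $ k} \<inter> G k = {a $ k, b $ k})"
    using assms(3) unfolding mac_mesh_def by (elim conjE exE) (rule that)
  have "\<exists>f :: int \<Rightarrow> real. strict_mono f \<and> (\<forall>t. \<exists>n. f n \<le> t \<and> t < f (n + 1)) \<and>
      (\<forall>a b. a < b \<longrightarrow> {a..b} \<inter> G k = {a, b} \<longrightarrow> (\<exists>n. a = f n \<and> b = f (n + 1)))" for k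
  proof -
    obtain f :: "int \<Rightarrow> real" where "strict_mono f" "\<And>t. \<exists>n. f n \<le> t \<and> t < f (n + 1)"
      "\<And>a b. a < b \<Longrightarrow> {a..b} \<inter> G k = {a, b} \<Longrightarrow> \<exists>n. a = f n \<and> b = f (n + 1)"
      using finite_set_enumeration[OF G[rule_format, of k]] by metis
    then show ?thesis by (intro exI[of _ f]) simp
  qed
  then obtain g :: "'n \<Rightarrow> int \<Rightarrow> real" where g: "\<And>k. strict_mono (g k)"
    "\<And>k t. \<exists>n. g k n \<le> t \<and> t < g k (n + 1)"
    "\<And>k a b. a < b \<Longrightarrow> {a..b} \<inter> G k = {a, b} \<Longrightarrow> \<exists>n. a = g k n \<and> b = g k (n + 1)"
    by metis
  define K where "K m = (cbox (\<chi> k. g k (m k)) (\<chi> k. g k (m k + 1)) :: (real ^ 'n) set)" for m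
  define A where "A = {m. K m \<in> M}"
  have "finite A"
  proof (rule finite_subset)
    \<comment> \<open>The lower corner of a cell has its coordinates in the finite sets
      \<open>G k\<close>, and each \<open>g k\<close> is injective.\<close>
    show "A \<subseteq> (\<Pi>\<^sub>E k\<in>UNIV. g k -` G k)"
    proof
      fix m assume "m \<in> A"
      then obtain a b where ab: "K m = cbox a b" "\<And>k. a $ k < b $ k" "\<And>k. {a $ k..b $ k} \<inter> G k = {a $ k, b $ k}"
        using cells by (fastforce simp: A_def)
      have "cbox a b \<noteq> {}" using ab(2) by (simp add: interval_ne_empty_cart less_imp_le)
      then have "(\<chi> k. g k (m k)) = a" using ab(1) unfolding K_def eq_cbox by auto
      then have "a $ k = g k (m k)" for k by (simp add: vec_eq_iff)
      moreover have "a $ k \<in> G k" for k using ab(3)[of k] by blast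
      ultimately have "g k (m k) \<in> G k" for k by metis
      then show "m \<in> (\<Pi>\<^sub>E k\<in>UNIV. g k -` G k)" by auto
    qed
    show "finite (\<Pi>\<^sub>E k\<in>UNIV. g k -` G k)"
      using G g(1) by (intro finite_PiE finite_vimageI strict_mono_imp_inj_on) auto
  qed
  then interpret mac_grid g A
    using g(1,2) by unfold_locales
  have mesh_K: "mesh = K ` A"
    unfolding mesh_def cell_def K_def ..
  have "M \<subseteq> mesh"
  proof
    fix B assume B: "B \<in> M"
    then obtain a b where ab: "B = cbox a b" "\<And>k. a $ k < b $ k" "\<And>k. {a $ k..b $ k} \<inter> G k = {a $ k, b $ k}"
      using cells by fastforce
    have "\<exists>n. a $ k = g k n \<and> b $ k = g k (n + 1)" for k
      by (rule g(3)[OF ab(2,3)])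
    then obtain m where "\<And>k. a $ k = g k (m k) \<and> b $ k = g k (m k + 1)" by metis
    then have "a = (\<chi> k. g k (m k))" "b = (\<chi> k. g k (m k + 1))" by (simp_all add: vec_eq_iff)
    then have "B = K m" using ab(1) by (simp add: K_def)
    then show "B \<in> mesh" using B unfolding mesh_K by (auto simp: A_def)
  qed
  then have M: "mesh = M" unfolding mesh_K by (auto simp: A_def)
  have "\<Union>M = closure \<Omega>" using assms(3) by (simp add: mac_mesh_def)
  then have "dom = \<Omega>" using mac_domain_eq_interior_mesh[OF assms(2)] by (simp add: dom_def M)
  then show ?thesis using discrete_korn assms(4,5) M by simp
qed

end
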